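(* Let $(M,J,g)$ be a metallic pseudo-Riemannian manifold with $J^2=pJ+qI$, $p,q\in\mathbb{R}$, $p^2+4q\neq0$. Let $D$ be the metallic natural connection of $(M,J,g)$, let $\hat J,\hat g$ be the generalized metallic pseudo-Riemannian structure on $TM\oplus T^*M$ defined by $(J,g)$, and let $$\hat D_{X+\alpha}(Y+\beta):=D_XY+D_X\beta$$ for all $X,Y\in C^\infty(TM)$, $\alpha,\beta\in C^\infty(T^*M)$. Then $$\hat D\hat J=0,\qquad \hat D\hat g=0.$$ Moreover, $T^{\hat D}(X+\alpha,Y+\beta)=T^D(X,Y)$ for all $X,Y\in C^\infty(TM)$ and $\alpha,\beta\in C^\infty(T^*M)$, and $\hat D$ is flat if and only if $D$ is flat.
   Context: A metallic pseudo-Riemannian manifold $(M,J,g)$ is a pseudo-Riemannian manifold $(M,g)$ with a $(1,1)$-tensor field $J$ such that $g(JX,Y)=g(X,JY)$ for all vector fields $X,Y$ and $J^2=pJ+qI$ for some real $p,q$. With $\nabla$ the Levi-Civita connection of $g$, the metallic natural connection is $$D_XY:=\nabla_XY+\frac{2}{p^2+4q}J\big((\nabla_XJ)Y\big)-\frac{p}{p^2+4q}(\nabla_XJ)Y;$$ it acts on 1-forms by $(D_X\beta)(Z)=X(\beta(Z))-\beta(D_XZ)$. Let $\flat_g:TM\to T^*M$, $\flat_g(X)=g(X,\cdot)$, $\sharp_g:=\flat_g^{-1}$, and $(J^*\alpha)(X):=\alpha(JX)$. The generalized metallic pseudo-Riemannian structure defined by $(J,g)$ is the pair $$\hat J(X+\alpha):=JX+\flat_g(X)-J^*\alpha+p\alpha,$$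 $$\hat g(X+\alpha,Y+\beta):=g(X,Y)+g(\sharp_g\alpha,\sharp_g\beta)+\frac{p}{p^2+4q}\big(\alpha(Y)+\beta(X)\big)-\frac{2}{p^2+4q}\big(\alpha(JY)+\beta(JX)\big).$$ The conditions $\hat D\hat J=0$ and $\hat D\hat g=0$ mean $\hat D_\sigma(\hat J\tau)=\hat J(\hat D_\sigma\tau)$ and $X(\hat g(\tau,\rho))=\hat g(\hat D_\sigma\tau,\rho)+\hat g(\tau,\hat D_\sigma\rho)$ for all sections $\sigma=X+\alpha$, $\tau,\rho$ of $TM\oplus T^*M$. Let $[X+\alpha,Y+\beta]_D:=[X,Y]+D_X\beta-D_Y\alpha$. The torsion and curvature of $\hat D$ are $$T^{\hat D}(\sigma,\tau):=\hat D_\sigma\tau-\hat D_\tau\sigma-[\sigma,\tau]_D,\qquad R^{\hat D}(\sigma,\tau)\rho:=\hat D_\sigma\hat D_\tau\rho-\hat D_\tau\hat D_\sigma\rho-\hat D_{[\sigma,\tau]_D}\rho,$$ and $T^D(X,Y)=D_XY-D_YX-[X,Y]$. A connection is flat if its curvature vanishes. *)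

theory Defs
  imports "HOL-Analysis.Analysis" "HOL-Library.Function_Algebras"
begin

text \<open>
  Tangent vectors, covectors and (sections of) the bundles built from them are all represented by
  functions, with the pointwise vector space structure: sums come from \<^theory>\<open>HOL-Library.Function_Algebras\<close>
  (and componentwise sums of pairs from \<^theory>\<open>HOL-Analysis.Product_Vector\<close>), scalar multiplication from
  the following instance.
\<close>

instantiation "fun" :: (type, scaleR) scaleR
begin

definition scaleR_fun_def: "r *\<^sub>R f = (\<lambda>x. r *\<^sub>R f x)"

instance ..

end

instance "fun" :: (type, real_vector) real_vector
  by standard
    (simp_all add: scaleR_fun_def fun_eq_iff scaleR_add_right scaleR_add_left)


section \<open>Smooth manifolds\<close>

text \<open>\<open>C\<^sup>k\<close> and \<open>C\<^sup>\<infinity>\<close> maps; these notions are only used for open \<open>S\<close>.\<close>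

primrec Ck_on :: "nat \<Rightarrow> 'a::euclidean_space set \<Rightarrow> ('a \<Rightarrow> 'b::real_normed_vector) \<Rightarrow> bool" where
  "Ck_on 0 S f \<longleftrightarrow> continuous_on S f"
| "Ck_on (Suc k) S f \<longleftrightarrow>
     (\<forall>x\<in>S. f differentiable (at x)) \<and> (\<forall>v. Ck_on k S (\<lambda>x. frechet_derivative f (at x) v))"

definition smooth_on :: "'a::euclidean_space set \<Rightarrow> ('a \<Rightarrow> 'b::real_normed_vector) \<Rightarrow> bool" where
  "smooth_on S f \<longleftrightarrow> (\<forall>k. Ck_on k S f)"

text \<open>A chart \<open>(U, \<phi>)\<close> is a homeomorphism from an open set \<open>U\<close> onto an open subset of the model space.\<close>

type_synonym ('m, 'e) chart = "'m set \<times> ('m \<Rightarrow> 'e)"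

definition is_chart :: "('m::topological_space, 'e::euclidean_space) chart \<Rightarrow> bool" where
  "is_chart c \<longleftrightarrow> (case c of (U, \<phi>) \<Rightarrow>
     open U \<and> open (\<phi> ` U) \<and> homeomorphism U (\<phi> ` U) \<phi> (inv_into U \<phi>))"

text \<open>
  The manifold is the whole type \<open>'m\<close>, with the smooth structure generated by the atlas \<open>A\<close>
  (which need not be maximal).
\<close>

definition smooth_manifold ::
  "('m::{t2_space, second_countable_topology}, 'e::euclidean_space) chart set \<Rightarrow> bool" where
  "smooth_manifold A \<longleftrightarrow>
     (\<forall>c\<in>A. is_chart c) \<and> (\<Union>(U, \<phi>)\<in>A. U) = UNIV \<and>
     (\<forall>(U, \<phi>)\<in>A. \<forall>(V, \<psi>)\<in>A. smooth_on (\<phi> ` (U \<inter> V)) (\<psi> \<circ> inv_into U \<phi>))"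

definition smooth_functions :: "('m, 'e::euclidean_space) chart set \<Rightarrow> ('m \<Rightarrow> real) set" where
  "smooth_functions A = {f. \<forall>(U, \<phi>)\<in>A. smooth_on (\<phi> ` U) (f \<circ> inv_into U \<phi>)}"


section \<open>Tangent and cotangent vectors, vector fields and 1-forms\<close>

definition lin_on :: "'a::real_vector set \<Rightarrow> ('a \<Rightarrow> 'b::real_vector) \<Rightarrow> bool" where
  "lin_on S h \<longleftrightarrow>
     (\<forall>v\<in>S. \<forall>w\<in>S. h (v + w) = h v + h w) \<and> (\<forall>r. \<forall>v\<in>S. h (r *\<^sub>R v) = r *\<^sub>R h v)"

type_synonym 'm tvec = "('m \<Rightarrow> real) \<Rightarrow> real"
type_synonym 'm covec = "'m tvec \<Rightarrow> real"
type_synonym 'm vfield = "'m \<Rightarrow> 'm tvec"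
type_synonym 'm form = "'m \<Rightarrow> 'm covec"

text \<open>
  Tangent vectors at \<open>x\<close> are the derivations at \<open>x\<close> of the algebra of smooth functions. They are made
  total functions by the value 0 on non-smooth functions, and likewise covectors at \<open>x\<close> by
  the value 0 outside the tangent space at \<open>x\<close>, so that equality is equality in the vector space.
\<close>

definition tangent_space :: "('m, 'e::euclidean_space) chart set \<Rightarrow> 'm \<Rightarrow> 'm tvec set" where
  "tangent_space A x = {v.
     lin_on (smooth_functions A) v \<and>
     (\<forall>f\<in>smooth_functions A. \<forall>h\<in>smooth_functions A. v (f * h) = f x * v h + h x * v f) \<and>
     (\<forall>f. f \<notin> smooth_functions A \<longrightarrow> v f = 0)}"

definition cotangent_space :: "('m, 'e::euclidean_space) chart set \<Rightarrow> 'm \<Rightarrow> 'm covec set" where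
  "cotangent_space A x = {a.
     lin_on (tangent_space A x) a \<and> (\<forall>v. v \<notin> tangent_space A x \<longrightarrow> a v = 0)}"

definition extend_zero :: "'a set \<Rightarrow> ('a \<Rightarrow> real) \<Rightarrow> 'a \<Rightarrow> real" where
  "extend_zero S h = (\<lambda>v. if v \<in> S then h v else 0)"

text \<open>\<open>X(f)\<close>, \<open>\<alpha>(X)\<close>, \<open>g(X, Y)\<close>, \<open>JX\<close> and \<open>fX\<close> (the latter also for 1-forms)\<close>

definition vf_apply :: "'m vfield \<Rightarrow> ('m \<Rightarrow> real) \<Rightarrow> 'm \<Rightarrow> real" where
  "vf_apply X f = (\<lambda>x. X x f)"

definition form_apply :: "'m form \<Rightarrow> 'm vfield \<Rightarrow> 'm \<Rightarrow> real" where
  "form_apply \<alpha> X = (\<lambda>x. \<alpha> x (X x))"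

definition metric_apply ::
  "('m \<Rightarrow> 'm tvec \<Rightarrow> 'm tvec \<Rightarrow> real) \<Rightarrow> 'm vfield \<Rightarrow> 'm vfield \<Rightarrow> 'm \<Rightarrow> real" where
  "metric_apply g X Y = (\<lambda>x. g x (X x) (Y x))"

definition endo_apply :: "('m \<Rightarrow> 'm tvec \<Rightarrow> 'm tvec) \<Rightarrow> 'm vfield \<Rightarrow> 'm vfield" where
  "endo_apply J X = (\<lambda>x. J x (X x))"

definition fmult :: "('m \<Rightarrow> real) \<Rightarrow> ('m \<Rightarrow> 'a::real_vector) \<Rightarrow> 'm \<Rightarrow> 'a" where
  "fmult f X = (\<lambda>x. f x *\<^sub>R X x)"

definition vector_fields :: "('m, 'e::euclidean_space) chart set \<Rightarrow> 'm vfield set" where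
  "vector_fields A = {X.
     (\<forall>x. X x \<in> tangent_space A x) \<and>
     (\<forall>f\<in>smooth_functions A. vf_apply X f \<in> smooth_functions A)}"

definition one_forms :: "('m, 'e::euclidean_space) chart set \<Rightarrow> 'm form set" where
  "one_forms A = {\<alpha>.
     (\<forall>x. \<alpha> x \<in> cotangent_space A x) \<and>
     (\<forall>X\<in>vector_fields A. form_apply \<alpha> X \<in> smooth_functions A)}"

definition lie_bracket :: "'m vfield \<Rightarrow> 'm vfield \<Rightarrow> 'm vfield" where
  "lie_bracket X Y = (\<lambda>x f. X x (vf_apply Y f) - Y x (vf_apply X f))"


section \<open>Metrics, endomorphism fields and connections\<close>

definition pseudo_riemannian_metric ::
  "('m, 'e::euclidean_space) chart set \<Rightarrow> ('m \<Rightarrow> 'm tvec \<Rightarrow> 'm tvec \<Rightarrow> real) \<Rightarrow> bool" where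
  "pseudo_riemannian_metric A g \<longleftrightarrow>
     (\<forall>x. (\<forall>v\<in>tangent_space A x. lin_on (tangent_space A x) (g x v)) \<and>
          (\<forall>v\<in>tangent_space A x. \<forall>w\<in>tangent_space A x. g x v w = g x w v) \<and>
          (\<forall>v\<in>tangent_space A x. (\<forall>w\<in>tangent_space A x. g x v w = 0) \<longrightarrow> v = 0)) \<and>
     (\<forall>X\<in>vector_fields A. \<forall>Y\<in>vector_fields A. metric_apply g X Y \<in> smooth_functions A)"

definition endomorphism_field ::
  "('m, 'e::euclidean_space) chart set \<Rightarrow> ('m \<Rightarrow> 'm tvec \<Rightarrow> 'm tvec) \<Rightarrow> bool" where
  "endomorphism_field A J \<longleftrightarrow>
     (\<forall>x. J x ` tangent_space A x \<subseteq> tangent_space A x \<and> lin_on (tangent_space A x) (J x)) \<and>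
     (\<forall>X\<in>vector_fields A. endo_apply J X \<in> vector_fields A)"

definition metallic_pseudo_riemannian ::
  "('m::{t2_space, second_countable_topology}, 'e::euclidean_space) chart set \<Rightarrow> real \<Rightarrow> real \<Rightarrow>
   ('m \<Rightarrow> 'm tvec \<Rightarrow> 'm tvec) \<Rightarrow> ('m \<Rightarrow> 'm tvec \<Rightarrow> 'm tvec \<Rightarrow> real) \<Rightarrow> bool" where
  "metallic_pseudo_riemannian A p q J g \<longleftrightarrow>
     smooth_manifold A \<and> pseudo_riemannian_metric A g \<and> endomorphism_field A J \<and>
     (\<forall>X\<in>vector_fields A. \<forall>Y\<in>vector_fields A.
        metric_apply g (endo_apply J X) Y = metric_apply g X (endo_apply J Y)) \<and>
     (\<forall>X\<in>vector_fields A.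
        endo_apply J (endo_apply J X) = p *\<^sub>R endo_apply J X + q *\<^sub>R X)"

text \<open>
  Torsion and curvature of \<open>D\<close> with respect to a bracket \<open>br\<close> of sections: the Lie bracket for a
  connection on the tangent bundle, \<open>bracket_D\<close> below for one on the generalized tangent bundle.
\<close>

definition torsion :: "('s \<Rightarrow> 's \<Rightarrow> 's) \<Rightarrow> ('s \<Rightarrow> 's \<Rightarrow> 's) \<Rightarrow> 's \<Rightarrow> 's \<Rightarrow> 's::ab_group_add" where
  "torsion br D \<sigma> \<tau> = D \<sigma> \<tau> - D \<tau> \<sigma> - br \<sigma> \<tau>"

definition curvature ::
  "('s \<Rightarrow> 's \<Rightarrow> 's) \<Rightarrow> ('s \<Rightarrow> 's \<Rightarrow> 's) \<Rightarrow> 's \<Rightarrow> 's \<Rightarrow> 's \<Rightarrow> 's::ab_group_add" where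
  "curvature br D \<sigma> \<tau> \<rho> = D \<sigma> (D \<tau> \<rho>) - D \<tau> (D \<sigma> \<rho>) - D (br \<sigma> \<tau>) \<rho>"

definition flat_connection ::
  "'s set \<Rightarrow> ('s \<Rightarrow> 's \<Rightarrow> 's) \<Rightarrow> ('s \<Rightarrow> 's \<Rightarrow> 's::ab_group_add) \<Rightarrow> bool" where
  "flat_connection S br D \<longleftrightarrow> (\<forall>\<sigma>\<in>S. \<forall>\<tau>\<in>S. \<forall>\<rho>\<in>S. curvature br D \<sigma> \<tau> \<rho> = 0)"

definition affine_connection ::
  "('m, 'e::euclidean_space) chart set \<Rightarrow> ('m vfield \<Rightarrow> 'm vfield \<Rightarrow> 'm vfield) \<Rightarrow> bool" where
  "affine_connection A D \<longleftrightarrow>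
     (\<forall>X\<in>vector_fields A. \<forall>Y\<in>vector_fields A. D X Y \<in> vector_fields A) \<and>
     (\<forall>X\<in>vector_fields A. \<forall>X'\<in>vector_fields A. \<forall>Y\<in>vector_fields A.
        D (X + X') Y = D X Y + D X' Y) \<and>
     (\<forall>f\<in>smooth_functions A. \<forall>X\<in>vector_fields A. \<forall>Y\<in>vector_fields A.
        D (fmult f X) Y = fmult f (D X Y)) \<and>
     (\<forall>X\<in>vector_fields A. \<forall>Y\<in>vector_fields A. \<forall>Y'\<in>vector_fields A.
        D X (Y + Y') = D X Y + D X Y') \<and>
     (\<forall>f\<in>smooth_functions A. \<forall>X\<in>vector_fields A. \<forall>Y\<in>vector_fields A.
        D X (fmult f Y) = fmult f (D X Y) + fmult (vf_apply X f) Y)"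

definition levi_civita_connection ::
  "('m, 'e::euclidean_space) chart set \<Rightarrow> ('m \<Rightarrow> 'm tvec \<Rightarrow> 'm tvec \<Rightarrow> real) \<Rightarrow>
   ('m vfield \<Rightarrow> 'm vfield \<Rightarrow> 'm vfield) \<Rightarrow> bool" where
  "levi_civita_connection A g D \<longleftrightarrow>
     affine_connection A D \<and>
     (\<forall>X\<in>vector_fields A. \<forall>Y\<in>vector_fields A. torsion lie_bracket D X Y = 0) \<and>
     (\<forall>X\<in>vector_fields A. \<forall>Y\<in>vector_fields A. \<forall>Z\<in>vector_fields A.
        vf_apply X (metric_apply g Y Z) = metric_apply g (D X Y) Z + metric_apply g Y (D X Z))"

definition cov_deriv_endo ::
  "('m vfield \<Rightarrow> 'm vfield \<Rightarrow> 'm vfield) \<Rightarrow> ('m \<Rightarrow> 'm tvec \<Rightarrow> 'm tvec) \<Rightarrow>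
   'm vfield \<Rightarrow> 'm vfield \<Rightarrow> 'm vfield" where
  "cov_deriv_endo D J X Y = D X (endo_apply J Y) - endo_apply J (D X Y)"

text \<open>Here \<open>nab\<close> stands for the Levi-Civita connection.\<close>

definition metallic_natural_connection ::
  "real \<Rightarrow> real \<Rightarrow> ('m \<Rightarrow> 'm tvec \<Rightarrow> 'm tvec) \<Rightarrow> ('m vfield \<Rightarrow> 'm vfield \<Rightarrow> 'm vfield) \<Rightarrow>
   'm vfield \<Rightarrow> 'm vfield \<Rightarrow> 'm vfield" where
  "metallic_natural_connection p q J nab X Y =
     nab X Y + (2 / (p\<^sup>2 + 4 * q)) *\<^sub>R endo_apply J (cov_deriv_endo nab J X Y)
             - (p / (p\<^sup>2 + 4 * q)) *\<^sub>R cov_deriv_endo nab J X Y"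

text \<open>
  The induced connection on 1-forms: \<open>D\<^sub>X \<beta>\<close> is the unique 1-form with
  \<open>(D\<^sub>X \<beta>)(Z) = X(\<beta>(Z)) - \<beta>(D\<^sub>X Z)\<close> for all vector fields \<open>Z\<close>.
\<close>

definition form_connection ::
  "('m, 'e::euclidean_space) chart set \<Rightarrow> ('m vfield \<Rightarrow> 'm vfield \<Rightarrow> 'm vfield) \<Rightarrow>
   'm vfield \<Rightarrow> 'm form \<Rightarrow> 'm form" where
  "form_connection A D X \<beta> = (THE \<gamma>. \<gamma> \<in> one_forms A \<and>
     (\<forall>Z\<in>vector_fields A.
        form_apply \<gamma> Z = vf_apply X (form_apply \<beta> Z) - form_apply \<beta> (D X Z)))"


section \<open>The generalized tangent bundle\<close>

text \<open>A section \<open>X + \<alpha>\<close> of \<open>TM \<oplus> T\<^sup>*M\<close> is the pair \<open>(X, \<alpha>)\<close>.\<close>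

type_synonym 'm gsec = "'m vfield \<times> 'm form"

definition gen_sections :: "('m, 'e::euclidean_space) chart set \<Rightarrow> 'm gsec set" where
  "gen_sections A = vector_fields A \<times> one_forms A"

definition flat_at ::
  "('m, 'e::euclidean_space) chart set \<Rightarrow> ('m \<Rightarrow> 'm tvec \<Rightarrow> 'm tvec \<Rightarrow> real) \<Rightarrow>
   'm \<Rightarrow> 'm tvec \<Rightarrow> 'm covec" where
  "flat_at A g x v = extend_zero (tangent_space A x) (g x v)"

definition flat ::
  "('m, 'e::euclidean_space) chart set \<Rightarrow> ('m \<Rightarrow> 'm tvec \<Rightarrow> 'm tvec \<Rightarrow> real) \<Rightarrow>
   'm vfield \<Rightarrow> 'm form" where
  "flat A g X = (\<lambda>x. flat_at A g x (X x))"

definition sharp ::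
  "('m, 'e::euclidean_space) chart set \<Rightarrow> ('m \<Rightarrow> 'm tvec \<Rightarrow> 'm tvec \<Rightarrow> real) \<Rightarrow>
   'm form \<Rightarrow> 'm vfield" where
  "sharp A g \<alpha> = (\<lambda>x. inv_into (tangent_space A x) (flat_at A g x) (\<alpha> x))"

definition dual_endo ::
  "('m, 'e::euclidean_space) chart set \<Rightarrow> ('m \<Rightarrow> 'm tvec \<Rightarrow> 'm tvec) \<Rightarrow> 'm form \<Rightarrow> 'm form" where
  "dual_endo A J \<alpha> = (\<lambda>x. extend_zero (tangent_space A x) (\<lambda>v. \<alpha> x (J x v)))"

fun gen_J ::
  "('m, 'e::euclidean_space) chart set \<Rightarrow> real \<Rightarrow> ('m \<Rightarrow> 'm tvec \<Rightarrow> 'm tvec) \<Rightarrow>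
   ('m \<Rightarrow> 'm tvec \<Rightarrow> 'm tvec \<Rightarrow> real) \<Rightarrow> 'm gsec \<Rightarrow> 'm gsec" where
  "gen_J A p J g (X, \<alpha>) = (endo_apply J X, flat A g X - dual_endo A J \<alpha> + p *\<^sub>R \<alpha>)"

fun gen_g ::
  "('m, 'e::euclidean_space) chart set \<Rightarrow> real \<Rightarrow> real \<Rightarrow> ('m \<Rightarrow> 'm tvec \<Rightarrow> 'm tvec) \<Rightarrow>
   ('m \<Rightarrow> 'm tvec \<Rightarrow> 'm tvec \<Rightarrow> real) \<Rightarrow> 'm gsec \<Rightarrow> 'm gsec \<Rightarrow> 'm \<Rightarrow> real" where
  "gen_g A p q J g (X, \<alpha>) (Y, \<beta>) =
     metric_apply g X Y + metric_apply g (sharp A g \<alpha>) (sharp A g \<beta>)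
     + (p / (p\<^sup>2 + 4 * q)) *\<^sub>R (form_apply \<alpha> Y + form_apply \<beta> X)
     - (2 / (p\<^sup>2 + 4 * q)) *\<^sub>R (form_apply \<alpha> (endo_apply J Y) + form_apply \<beta> (endo_apply J X))"

fun bracket_D ::
  "('m, 'e::euclidean_space) chart set \<Rightarrow> ('m vfield \<Rightarrow> 'm vfield \<Rightarrow> 'm vfield) \<Rightarrow>
   'm gsec \<Rightarrow> 'm gsec \<Rightarrow> 'm gsec" where
  "bracket_D A D (X, \<alpha>) (Y, \<beta>) =
     (lie_bracket X Y, form_connection A D X \<beta> - form_connection A D Y \<alpha>)"

fun gen_connection ::
  "('m, 'e::euclidean_space) chart set \<Rightarrow> ('m vfield \<Rightarrow> 'm vfield \<Rightarrow> 'm vfield) \<Rightarrow>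
   'm gsec \<Rightarrow> 'm gsec \<Rightarrow> 'm gsec" where
  "gen_connection A D (X, \<alpha>) (Y, \<beta>) = (D X Y, form_connection A D X \<beta>)"

definition parallel_gen_endo ::
  "('m, 'e::euclidean_space) chart set \<Rightarrow> ('m gsec \<Rightarrow> 'm gsec \<Rightarrow> 'm gsec) \<Rightarrow>
   ('m gsec \<Rightarrow> 'm gsec) \<Rightarrow> bool" where
  "parallel_gen_endo A Dh Jh \<longleftrightarrow>
     (\<forall>\<sigma>\<in>gen_sections A. \<forall>\<tau>\<in>gen_sections A. Dh \<sigma> (Jh \<tau>) = Jh (Dh \<sigma> \<tau>))"

definition parallel_gen_metric ::
  "('m, 'e::euclidean_space) chart set \<Rightarrow> ('m gsec \<Rightarrow> 'm gsec \<Rightarrow> 'm gsec) \<Rightarrow>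
   ('m gsec \<Rightarrow> 'm gsec \<Rightarrow> 'm \<Rightarrow> real) \<Rightarrow> bool" where
  "parallel_gen_metric A Dh gh \<longleftrightarrow>
     (\<forall>\<sigma>\<in>gen_sections A. \<forall>\<tau>\<in>gen_sections A. \<forall>\<rho>\<in>gen_sections A.
        vf_apply (fst \<sigma>) (gh \<tau> \<rho>) = gh (Dh \<sigma> \<tau>) \<rho> + gh \<tau> (Dh \<sigma> \<rho>))"

end

theory Submission
  imports Defs
begin

text \<open>
  Covariant differentiation of \<open>J\<^sup>2 = pJ + qI\<close> gives \<open>(\<nabla>\<^sub>XJ)J = p \<nabla>\<^sub>XJ - J(\<nabla>\<^sub>XJ)\<close>, and \<open>\<nabla>\<^sub>XJ\<close> is
  \<open>g\<close>-symmetric; hence \<open>DJ = 0\<close> and \<open>Dg = 0\<close>. Because of \<open>Dg = 0\<close>, the induced connection on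
  1-forms satisfies \<open>D\<^sub>X(\<flat>W) = \<flat>(D\<^sub>XW)\<close>. Every 1-form is \<open>\<flat>W\<close> for a vector field \<open>W\<close>, so all
  claims about \<open>TM \<oplus> T\<^sup>*M\<close> reduce to identities between vector fields.

  With tangent vectors defined as derivations, two facts behind this need analysis: a 1-form is
  determined by its values on global vector fields (bump functions and Hadamard's lemma give
  local frames of global fields), and \<open>\<sharp>\<alpha>\<close> is smooth (Cramer's rule in such a frame).
\<close>

section \<open>Calculus of \<open>C\<^sup>k\<close> maps\<close>

text \<open>The constants in \<open>D\<close> come from \<open>S = 2J - p\<close>. The metallic
  relation says \<open>S^2 = p^2 + 4q\<close>, a nonzero scalar, so \<open>S\<close> is invertible,
  and \<open>D\<close> is the mean of the Levi-Civita connection and its conjugate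
  \<open>S^-1 nab S\<close>: the correction added to \<open>nab_X\<close> is
  \<open>(1/2) S^-1 (nab_X S) = S (nab_X J) / (p^2 + 4q)\<close>. Conjugation by \<open>S\<close>
  exchanges the two connections because \<open>S^2\<close> is a scalar, whence
  \<open>DJ = 0\<close>. It also preserves metric compatibility because
  \<open>g(SX, SY) = (p^2 + 4q) g(X, Y)\<close>, whence \<open>Dg = 0\<close>. The calculations
  below carry this out in terms of \<open>J\<close> itself.

  The analytic part is shaped by the fact that derivations act only on globally smooth functions,
  and that symmetry of \<open>J\<close>, the metallic relation and the axioms of connections speak
  of global fields only. Every coordinate expression therefore has to be cut off before a tangent
  vector can be applied to it, and every pointwise identity has to be tested on a global field
  through the given vector.\<close>

lemma Ck_on_SucD: "Ck_on (Suc k) S f \<Longrightarrow> Ck_on k S f"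
proof (induction k arbitrary: f)
  case 0
  then show ?case
    by (auto intro!: continuous_at_imp_continuous_on differentiable_imp_continuous_within)
next
  case (Suc k)
  then show ?case
    unfolding Ck_on.simps(2)[of "Suc k"] Ck_on.simps(2)[of k S f] by blast
qed

lemma Ck_on_subset: "Ck_on k S f \<Longrightarrow> T \<subseteq> S \<Longrightarrow> Ck_on k T f"
  by (induction k arbitrary: f) (auto intro: continuous_on_subset)

text \<open>Openness of \<open>S\<close> is essential: a derivative at \<open>x\<close> depends on
  the values of the map in a whole neighbourhood of \<open>x\<close>.\<close>

lemma Ck_on_cong:
  assumes "open S" "\<And>x. x \<in> S \<Longrightarrow> f x = g x"
  shows "Ck_on k S f \<longleftrightarrow> Ck_on k S g"
proof -
  have "Ck_on k S g" if "Ck_on k S f" "\<And>x. x \<in> S \<Longrightarrow> f x = g x" for f g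
    using that
  proof (induction k arbitrary: f g)
    case 0
    then show ?case
      by (metis Ck_on.simps(1) continuous_on_cong)
  next
    case (Suc k)
    then have dif: "f differentiable (at x)" if "x \<in> S" for x
      using that by simp
    have 1: "g differentiable (at x)" if "x \<in> S" for x
      using dif[OF that] Suc.prems(2) assms(1) that
      unfolding differentiable_def by (meson has_derivative_transform_within_open)
    have 2: "frechet_derivative f (at x) = frechet_derivative g (at x)" if "x \<in> S" for x
      using frechet_derivative_transform_within_open[OF dif[OF that] assms(1) that] Suc.prems(2)
      by blast
    have "Ck_on k S (\<lambda>x. frechet_derivative g (at x) v)" for v
      using Suc.IH[of "\<lambda>x. frechet_derivative f (at x) v" "\<lambda>x. frechet_derivative g (at x) v"]
        Suc.prems(1) 2 by simp
    then show ?case using 1 by simp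
  qed
  then show ?thesis using assms(2) by metis
qed

text \<open>Together with \<open>Ck_on_SucE\<close> this replaces \<open>frechet_derivative\<close>
  by any explicit derivative, so that each closure property becomes an induction on \<open>k\<close>
  over a differentiation rule.\<close>

lemma Ck_on_SucI:
  assumes "open S" "\<And>x. x \<in> S \<Longrightarrow> (f has_derivative f' x) (at x)"
    and "\<And>v. Ck_on k S (\<lambda>x. f' x v)"
  shows "Ck_on (Suc k) S f"
proof -
  have "frechet_derivative f (at x) = f' x" if "x \<in> S" for x
    using frechet_derivative_at[OF assms(2)[OF that]] by simp
  then have "Ck_on k S (\<lambda>x. frechet_derivative f (at x) v)" for v
    using assms(3)[of v] Ck_on_cong[OF assms(1), of "\<lambda>x. f' x v" "\<lambda>x. frechet_derivative f (at x) v"]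
    by simp
  moreover have "\<forall>x\<in>S. f differentiable (at x)"
    using assms(2) by (auto simp: differentiable_def)
  ultimately show ?thesis by simp
qed

lemma Ck_on_SucE:
  assumes "Ck_on (Suc k) S f"
  obtains f' where "\<And>x. x \<in> S \<Longrightarrow> (f has_derivative f' x) (at x)"
    "\<And>v. Ck_on k S (\<lambda>x. f' x v)"
  using assms frechet_derivative_works[of f] that[of "\<lambda>x. frechet_derivative f (at x)"] by auto

text \<open>The neighbourhoods are open, so continuity and derivatives at their points are
  intrinsic. This permits gluing a function on a manifold from pieces treated by different
  arguments.\<close>

lemma Ck_on_local:
  assumes "\<And>x. x \<in> S \<Longrightarrow> \<exists>T. open T \<and> x \<in> T \<and> Ck_on k T f"
  shows "Ck_on k S f"
  using assms
proof (induction k arbitrary: f)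
  case 0
  have "continuous (at x) f" if x: "x \<in> S" for x
  proof -
    obtain T where "open T" "x \<in> T" "continuous_on T f"
      using 0[OF x] by auto
    then show ?thesis by (simp add: continuous_on_eq_continuous_at)
  qed
  then show ?case by (simp add: continuous_at_imp_continuous_on)
next
  case (Suc k)
  have *: "\<exists>T. open T \<and> x \<in> T \<and> (\<forall>x\<in>T. f differentiable (at x)) \<and>
      (\<forall>v. Ck_on k T (\<lambda>x. frechet_derivative f (at x) v))" if "x \<in> S" for x
    using Suc.prems[OF that] by simp
  have "Ck_on k S (\<lambda>x. frechet_derivative f (at x) v)" for v
    by (rule Suc.IH) (use * in blast)
  moreover have "\<forall>x\<in>S. f differentiable (at x)"
    using * by blast
  ultimately show ?case by simp
qed

lemma Ck_on_const: "open S \<Longrightarrow> Ck_on k S (\<lambda>x. c)"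
proof (induction k arbitrary: c)
  case (Suc k)
  then show ?case
    by (intro Ck_on_SucI[where f' = "\<lambda>x v. 0"]) auto
qed simp

lemma Ck_on_bounded_linear:
  assumes "open S" "bounded_linear h"
  shows "Ck_on k S h"
proof (cases k)
  case 0
  then show ?thesis by (simp add: assms(2) linear_continuous_on)
next
  case (Suc n)
  have "Ck_on (Suc n) S h"
    using assms by (intro Ck_on_SucI[where f' = "\<lambda>x. h"])
      (auto simp: bounded_linear_imp_has_derivative Ck_on_const)
  then show ?thesis by (simp add: Suc)
qed

lemma Ck_on_bounded_linear_compose:
  assumes "open S" "bounded_linear h" "Ck_on k S f"
  shows "Ck_on k S (\<lambda>x. h (f x))"
  using assms(3)
proof (induction k arbitrary: f)
  case 0
  then show ?case
    using bounded_linear.continuous_on[OF assms(2)] by auto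
next
  case (Suc k)
  obtain f' where f': "\<And>x. x \<in> S \<Longrightarrow> (f has_derivative f' x) (at x)"
    "\<And>v. Ck_on k S (\<lambda>x. f' x v)"
    using Ck_on_SucE[OF Suc.prems] by blast
  show ?case
    using Suc.IH[OF f'(2)] bounded_linear.has_derivative[OF assms(2) f'(1)]
    by (intro Ck_on_SucI[OF assms(1), where f' = "\<lambda>x v. h (f' x v)"]) auto
qed

lemma Ck_on_add:
  assumes "open S" "Ck_on k S f" "Ck_on k S g"
  shows "Ck_on k S (\<lambda>x. f x + g x)"
  using assms(2,3)
proof (induction k arbitrary: f g)
  case 0
  then show ?case by (auto intro: continuous_intros)
next
  case (Suc k)
  obtain f' where f': "\<And>x. x \<in> S \<Longrightarrow> (f has_derivative f' x) (at x)"
    "\<And>v. Ck_on k S (\<lambda>x. f' x v)"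
    using Ck_on_SucE[OF Suc.prems(1)] by blast
  obtain g' where g': "\<And>x. x \<in> S \<Longrightarrow> (g has_derivative g' x) (at x)"
    "\<And>v. Ck_on k S (\<lambda>x. g' x v)"
    using Ck_on_SucE[OF Suc.prems(2)] by blast
  show ?case
    using Suc.IH[OF f'(2) g'(2)] has_derivative_add[OF f'(1) g'(1)]
    by (intro Ck_on_SucI[OF assms(1), where f' = "\<lambda>x v. f' x v + g' x v"]) auto
qed

lemma Ck_on_mult:
  fixes f g :: "'a::euclidean_space \<Rightarrow> real"
  assumes "open S" "Ck_on k S f" "Ck_on k S g"
  shows "Ck_on k S (\<lambda>x. f x * g x)"
  using assms(2,3)
proof (induction k arbitrary: f g)
  case 0
  then show ?case by (auto intro: continuous_intros)
next
  case (Suc k)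
  obtain f' where f': "\<And>x. x \<in> S \<Longrightarrow> (f has_derivative f' x) (at x)"
    "\<And>v. Ck_on k S (\<lambda>x. f' x v)"
    using Ck_on_SucE[OF Suc.prems(1)] by blast
  obtain g' where g': "\<And>x. x \<in> S \<Longrightarrow> (g has_derivative g' x) (at x)"
    "\<And>v. Ck_on k S (\<lambda>x. g' x v)"
    using Ck_on_SucE[OF Suc.prems(2)] by blast
  \<comment> \<open>The product rule contains \<open>f\<close> and \<open>g\<close>
    undifferentiated, which are only needed one degree lower; \<open>Ck_on_SucD\<close> supplies
    that.\<close>
  show ?case
    using Suc.IH Ck_on_SucD[OF Suc.prems(1)] Ck_on_SucD[OF Suc.prems(2)] f' g'
    by (intro Ck_on_SucI[OF assms(1), where f' = "\<lambda>x v. f x * g' x v + f' x v * g x"] Ck_on_add[OF assms(1)]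
        has_derivative_mult) auto
qed

lemma Ck_on_sum:
  assumes "open S" "finite I" "\<And>i. i \<in> I \<Longrightarrow> Ck_on k S (f i)"
  shows "Ck_on k S (\<lambda>x. \<Sum>i\<in>I. f i x)"
  using assms(2,3) by induction (auto simp: Ck_on_const Ck_on_add assms(1))

lemma Ck_on_inverse:
  fixes f :: "'a::euclidean_space \<Rightarrow> real"
  assumes "open S" "Ck_on k S f" "\<And>x. x \<in> S \<Longrightarrow> f x \<noteq> 0"
  shows "Ck_on k S (\<lambda>x. inverse (f x))"
  using assms(2,3)
proof (induction k)
  case 0
  then show ?case by (auto intro: continuous_intros)
next
  case (Suc k)
  obtain f' where f': "\<And>x. x \<in> S \<Longrightarrow> (f has_derivative f' x) (at x)"
    "\<And>v. Ck_on k S (\<lambda>x. f' x v)"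
    using Ck_on_SucE[OF Suc.prems(1)] by blast
  have inv: "Ck_on k S (\<lambda>x. inverse (f x))"
    using Suc Ck_on_SucD by blast
  have "Ck_on k S (\<lambda>x. (-1) * (inverse (f x) * f' x v * inverse (f x)))" for v
    using inv f'(2) by (intro Ck_on_mult[OF assms(1)] Ck_on_const[OF assms(1)])
  then have "Ck_on k S (\<lambda>x. - (inverse (f x) * f' x v * inverse (f x)))" for v
    by simp
  then show ?case
    using f'(1) Suc.prems(2)
    by (intro Ck_on_SucI[OF assms(1), where f' = "\<lambda>x v. - (inverse (f x) * f' x v * inverse (f x))"]
        Deriv.has_derivative_inverse) auto
qed

lemma Ck_on_compose:
  fixes f :: "'b::euclidean_space \<Rightarrow> real" and h :: "'a::euclidean_space \<Rightarrow> 'b"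
  assumes "open S" "Ck_on k S h" "Ck_on k T f" "h ` S \<subseteq> T"
  shows "Ck_on k S (\<lambda>x. f (h x))"
  using assms(2,3)
proof (induction k arbitrary: f)
  case 0
  then show ?case
    using assms(4) continuous_on_compose2[of T f S h] by simp
next
  case (Suc k)
  obtain f' where f': "\<And>y. y \<in> T \<Longrightarrow> (f has_derivative f' y) (at y)"
    "\<And>v. Ck_on k T (\<lambda>y. f' y v)"
    using Ck_on_SucE[OF Suc.prems(2)] by blast
  obtain h' where h': "\<And>x. x \<in> S \<Longrightarrow> (h has_derivative h' x) (at x)"
    "\<And>v. Ck_on k S (\<lambda>x. h' x v)"
    using Ck_on_SucE[OF Suc.prems(1)] by blast
  \<comment> \<open>In \<open>f' (h x) (h' x v)\<close> both the base point and the direction vary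
    with \<open>x\<close>. Expanding the direction in the basis leaves products of scalar functions
    in which \<open>f'\<close> has a fixed direction \<open>b\<close>, and to these the induction
    hypothesis applies.\<close>
  have der: "((\<lambda>x. f (h x)) has_derivative (\<lambda>v. \<Sum>b\<in>Basis. (h' x v \<bullet> b) * f' (h x) b)) (at x)"
    if "x \<in> S" for x
  proof -
    have fx: "(f has_derivative f' (h x)) (at (h x))"
      using f'(1) assms(4) that by blast
    have lin: "linear (f' (h x))"
      using fx has_derivative_linear by blast
    have "f' (h x) w = (\<Sum>b\<in>Basis. (w \<bullet> b) * f' (h x) b)" for w
    proof -
      have "f' (h x) (\<Sum>b\<in>Basis. (w \<bullet> b) *\<^sub>R b) = (\<Sum>b\<in>Basis. (w \<bullet> b) *\<^sub>R f' (h x) b)"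
        by (simp add: lin linear_sum linear_cmul)
      then show ?thesis by (simp add: euclidean_representation)
    qed
    then have "(\<lambda>v. \<Sum>b\<in>Basis. (h' x v \<bullet> b) * f' (h x) b) = (\<lambda>v. f' (h x) (h' x v))"
      by (metis (no_types))
    then show ?thesis
      using has_derivative_compose[OF h'(1)[OF that] fx] by simp
  qed
  have "Ck_on k S (\<lambda>x. \<Sum>b\<in>Basis. (h' x v \<bullet> b) * f' (h x) b)" for v
    using Suc.IH[OF Ck_on_SucD[OF Suc.prems(1)] f'(2)] h'(2)
    by (intro Ck_on_sum[OF assms(1)] Ck_on_mult[OF assms(1)]
        Ck_on_bounded_linear_compose[OF assms(1) bounded_linear_inner_left]) auto
  then show ?case
    using der by (intro Ck_on_SucI[OF assms(1)])
qed

section \<open>Smooth maps between open subsets of Euclidean spaces\<close>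

lemma smooth_on_subset: "smooth_on S f \<Longrightarrow> T \<subseteq> S \<Longrightarrow> smooth_on T f"
  by (auto simp: smooth_on_def intro: Ck_on_subset)

lemma smooth_on_cong:
  "open S \<Longrightarrow> (\<And>x. x \<in> S \<Longrightarrow> f x = g x) \<Longrightarrow> smooth_on S f \<longleftrightarrow> smooth_on S g"
  unfolding smooth_on_def using Ck_on_cong[of S f g] by blast

lemma smooth_on_local:
  "(\<And>x. x \<in> S \<Longrightarrow> \<exists>T. open T \<and> x \<in> T \<and> smooth_on T f) \<Longrightarrow> smooth_on S f"
  unfolding smooth_on_def by (intro allI Ck_on_local) blast

lemma smooth_on_const: "open S \<Longrightarrow> smooth_on S (\<lambda>x. c)"
  by (simp add: smooth_on_def Ck_on_const)

lemma smooth_on_bounded_linear: "open S \<Longrightarrow> bounded_linear h \<Longrightarrow> smooth_on S h"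
  by (simp add: smooth_on_def Ck_on_bounded_linear)

lemma smooth_on_add: "open S \<Longrightarrow> smooth_on S f \<Longrightarrow> smooth_on S g \<Longrightarrow> smooth_on S (\<lambda>x. f x + g x)"
  by (simp add: smooth_on_def Ck_on_add)

lemma smooth_on_mult:
  fixes f g :: "'a::euclidean_space \<Rightarrow> real"
  shows "open S \<Longrightarrow> smooth_on S f \<Longrightarrow> smooth_on S g \<Longrightarrow> smooth_on S (\<lambda>x. f x * g x)"
  by (simp add: smooth_on_def Ck_on_mult)

lemma smooth_on_divide:
  fixes f g :: "'a::euclidean_space \<Rightarrow> real"
  shows "open S \<Longrightarrow> smooth_on S f \<Longrightarrow> smooth_on S g \<Longrightarrow> (\<And>x. x \<in> S \<Longrightarrow> g x \<noteq> 0) \<Longrightarrow>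
    smooth_on S (\<lambda>x. f x / g x)"
  by (simp add: smooth_on_def Ck_on_mult Ck_on_inverse divide_inverse)

lemma smooth_on_compose:
  fixes f :: "'b::euclidean_space \<Rightarrow> real"
  shows "open S \<Longrightarrow> smooth_on S h \<Longrightarrow> smooth_on T f \<Longrightarrow> h ` S \<subseteq> T \<Longrightarrow> smooth_on S (\<lambda>x. f (h x))"
  unfolding smooth_on_def using Ck_on_compose[of S _ h T f] by blast

lemma smooth_on_frechet_derivative:
  assumes "smooth_on S f"
  shows "smooth_on S (\<lambda>x. frechet_derivative f (at x) v)"
  unfolding smooth_on_def
proof
  fix k
  have "Ck_on (Suc k) S f" using assms by (simp add: smooth_on_def)
  then show "Ck_on k S (\<lambda>x. frechet_derivative f (at x) v)" by simp
qed

lemma smooth_on_differentiable: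
  assumes "smooth_on S f" "x \<in> S"
  shows "f differentiable (at x)"
proof -
  have "Ck_on (Suc 0) S f" using assms(1) by (simp only: smooth_on_def)
  then show ?thesis using assms(2) by simp
qed

lemma smooth_on_continuous: "smooth_on S f \<Longrightarrow> continuous_on S f"
  unfolding smooth_on_def by (metis Ck_on.simps(1))


section \<open>Bump functions\<close>

lemma poly_times_exp_minus_tendsto_0:
  fixes P :: "real poly"
  shows "((\<lambda>s. poly P s * exp (- s)) \<longlongrightarrow> 0) at_top"
proof -
  have "((\<lambda>s. \<Sum>i\<le>degree P. coeff P i * (s ^ i / exp s)) \<longlongrightarrow> (\<Sum>i\<le>degree P. coeff P i * 0)) at_top"
    by (intro tendsto_sum tendsto_mult tendsto_const tendsto_power_div_exp_0)
  then show ?thesis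
    by (simp add: poly_altdef sum_distrib_right exp_minus divide_inverse mult.assoc)
qed

text \<open>Admitting a polynomial factor makes the family of functions
  \<open>exp (- (1 / t))\<close> closed under differentiation: with \<open>s = 1 / t\<close> and
  \<open>ds/dt = - s^2\<close>, the factor \<open>P\<close> turns into
  \<open>s^2 (P - P')\<close>.\<close>

definition flat_exp :: "real poly \<Rightarrow> real \<Rightarrow> real" where
  "flat_exp P t = (if t \<le> 0 then 0 else poly P (1 / t) * exp (- (1 / t)))"

lemma flat_exp_has_real_derivative:
  "(flat_exp P has_real_derivative flat_exp ([:0, 0, 1:] * (P - pderiv P)) t) (at t)"
proof (cases t "0::real" rule: linorder_cases)
  case less
  have "((\<lambda>t. 0) has_real_derivative 0) (at t)" by simp
  then have "(flat_exp P has_real_derivative 0) (at t)"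
    by (rule has_field_derivative_transform_within_open[where S = "{..<0}"]) (use less in \<open>auto simp: flat_exp_def\<close>)
  then show ?thesis using less by (simp add: flat_exp_def)
next
  case greater
  have "((\<lambda>t. poly P (1 / t) * exp (- (1 / t))) has_real_derivative
      flat_exp ([:0, 0, 1:] * (P - pderiv P)) t) (at t)"
    using greater unfolding flat_exp_def
    by (auto intro!: derivative_eq_intros simp: field_simps power2_eq_square)
  then show ?thesis
    by (rule has_field_derivative_transform_within_open[where S = "{0<..}"]) (use greater in \<open>auto simp: flat_exp_def\<close>)
next
  case equal
  \<comment> \<open>With \<open>s = 1 / h\<close>, the difference quotient at 0 from the right is
    \<open>s * P(s) * exp (- s)\<close>; this explains the extra factor \<open>[:0, 1:]\<close>.
    From the left the quotient is identically 0.\<close>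
  have "((\<lambda>h. poly ([:0, 1:] * P) (inverse h) * exp (- inverse h)) \<longlongrightarrow> 0) (at_right 0)"
    using filterlim_compose[OF poly_times_exp_minus_tendsto_0 filterlim_inverse_at_top_right] by blast
  then have "((\<lambda>h. flat_exp P h / h) \<longlongrightarrow> 0) (at_right 0)"
    by (rule Lim_transform_eventually)
      (auto simp: eventually_at_right_field flat_exp_def field_simps intro!: exI[of _ 1])
  moreover have "((\<lambda>h. flat_exp P h / h) \<longlongrightarrow> 0) (at_left 0)"
    by (rule Lim_transform_eventually[of "\<lambda>h. 0"])
      (auto simp: eventually_at_left_field flat_exp_def intro!: exI[of _ "-1"])
  ultimately have "((\<lambda>h. flat_exp P h / h) \<longlongrightarrow> 0) (at 0)"
    by (simp add: filterlim_split_at)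
  then show ?thesis
    using equal by (simp add: DERIV_def flat_exp_def)
qed

lemma smooth_on_flat_exp: "smooth_on UNIV (flat_exp P)"
  unfolding smooth_on_def
proof
  fix k show "Ck_on k UNIV (flat_exp P)"
  proof (induction k arbitrary: P)
    case 0
    then show ?case
      using flat_exp_has_real_derivative DERIV_isCont by (fastforce intro: continuous_at_imp_continuous_on)
  next
    case (Suc k)
    show ?case
      using flat_exp_has_real_derivative[of P] Suc.IH
      by (intro Ck_on_SucI[where f' = "\<lambda>t. (*) (flat_exp ([:0, 0, 1:] * (P - pderiv P)) t)"] Ck_on_mult Ck_on_const)
        (auto simp: has_field_derivative_def)
  qed
qed

text \<open>\<open>flat_exp 1\<close> is positive exactly on positive numbers, and
  \<open>r^2 - |z - z0|^2\<close> is positive exactly on the ball. The bump has the value 1 at the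
  centre and is only positive elsewhere in the ball: later arguments evaluate it at the centre or
  divide by it.\<close>

lemma smooth_bump:
  fixes z0 :: "'a::euclidean_space"
  assumes "0 < r"
  obtains h :: "'a \<Rightarrow> real" where "smooth_on UNIV h" "h z0 = 1"
    "\<And>z. z \<in> ball z0 r \<Longrightarrow> h z > 0" "\<And>z. z \<notin> ball z0 r \<Longrightarrow> h z = 0"
proof -
  define u where "u = (\<lambda>z::'a. r\<^sup>2 - (z - z0) \<bullet> (z - z0))"
  define h where "h = (\<lambda>z. flat_exp 1 (u z) / flat_exp 1 (r\<^sup>2))"
  have norm: "u z = r\<^sup>2 - (dist z0 z)\<^sup>2" for z
    by (simp add: u_def dist_norm norm_minus_commute[of z0] power2_norm_eq_inner)
  have u: "smooth_on UNIV u"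
    unfolding smooth_on_def
  proof
    fix k
    have "Ck_on k UNIV (\<lambda>z::'a. (-2) * (z \<bullet> v) + 2 * (z0 \<bullet> v))" for k and v :: 'a
      by (intro Ck_on_add Ck_on_mult Ck_on_const Ck_on_bounded_linear bounded_linear_inner_left) auto
    moreover have "(u has_derivative (\<lambda>v. (-2) * (z \<bullet> v) + 2 * (z0 \<bullet> v))) (at z)" for z
      unfolding u_def
      by (auto intro!: derivative_eq_intros simp: algebra_simps inner_commute)
    ultimately have "Ck_on (Suc k) UNIV u" for k
      by (intro Ck_on_SucI) auto
    then show "Ck_on k UNIV u" using Ck_on_SucD by blast
  qed
  have pos: "flat_exp 1 (r\<^sup>2) > 0"
    using assms by (simp add: flat_exp_def)
  show ?thesis
  proof
    have "smooth_on UNIV (\<lambda>z. flat_exp 1 (u z))"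
      using smooth_on_compose[OF open_UNIV u smooth_on_flat_exp] by simp
    then show "smooth_on UNIV h"
      unfolding h_def using pos by (intro smooth_on_divide smooth_on_const) auto
    show "h z0 = 1" using pos by (simp add: h_def u_def)
    show "h z > 0" if "z \<in> ball z0 r" for z
    proof -
      have "u z > 0" using that assms by (simp add: norm power_strict_mono)
      then have "flat_exp 1 (u z) > 0" by (simp add: flat_exp_def)
      then show ?thesis using pos by (simp add: h_def)
    qed
    show "h z = 0" if "z \<notin> ball z0 r" for z
    proof -
      have "u z \<le> 0" using that assms by (simp add: norm power_mono)
      then show ?thesis by (simp add: h_def flat_exp_def)
    qed
  qed
qed


section \<open>Hadamard's lemma\<close>

text \<open>Differentiating \<open>F (z0 + t *\<^sub>R (z - z0))\<close> in \<open>z\<close> brings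
  out a factor \<open>t\<close>. Hence the weight \<open>t ^ m\<close> with \<open>m\<close>
  generalised in the induction; the application is to \<open>m = 0\<close>.\<close>

lemma Ck_on_integral_segment:
  fixes F :: "'a::euclidean_space \<Rightarrow> real"
  assumes "Ck_on k (ball z0 r) F"
  shows "Ck_on k (ball z0 r) (\<lambda>z. integral {0..1} (\<lambda>t. t ^ m * F (z0 + t *\<^sub>R (z - z0))))"
  using assms
proof (induction k arbitrary: F m)
  let ?B = "ball z0 r"
  have seg: "z0 + t *\<^sub>R (z - z0) \<in> ?B" if "z \<in> ?B" "t \<in> {0..1}" for z t
  proof -
    have "z0 + t *\<^sub>R (z - z0) = (1 - t) *\<^sub>R z0 + t *\<^sub>R z" by (simp add: algebra_simps)
    moreover have "z0 \<in> ?B" using that(1) by (metis ball_eq_empty centre_in_ball empty_iff not_le)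
    ultimately show ?thesis
      using convex_ball[of z0 r, unfolded convex_alt] that by auto
  qed
  have contp: "continuous_on (?B \<times> {0..1}) (\<lambda>p. snd p ^ m * F (z0 + snd p *\<^sub>R (fst p - z0)))"
    if "continuous_on ?B F" for F :: "'a \<Rightarrow> real" and m
    by (intro continuous_intros continuous_on_compose2[OF that]) (use seg in auto)
  have int: "(\<lambda>t. t ^ m * F (z0 + t *\<^sub>R (z - z0))) integrable_on {0..1}"
    if "continuous_on ?B F" "z \<in> ?B" for F :: "'a \<Rightarrow> real" and m z
    by (intro integrable_continuous_interval continuous_intros continuous_on_compose2[OF that(1)])
      (use seg that in auto)
  {
    case 0
    then have "continuous_on ?B F" by simp
    from integral_continuous_on_param[of ?B 0 1 "\<lambda>z t. t ^ m * F (z0 + t *\<^sub>R (z - z0))"] contp[OF this]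
    show ?case by (simp add: case_prod_unfold cbox_interval)
  next
    case (Suc k)
    define F' where "F' z = frechet_derivative F (at z)" for z
    have F': "(F has_derivative F' z) (at z)" if "z \<in> ?B" for z
      using Suc.prems that frechet_derivative_works[of F "at z"] unfolding F'_def by simp
    have contF: "continuous_on ?B F"
      using Suc.prems
      by (auto intro!: continuous_at_imp_continuous_on differentiable_imp_continuous_within)
    have contF': "continuous_on ?B (\<lambda>z. F' z v)" for v
    proof -
      have "Ck_on k ?B (\<lambda>z. F' z v)" using Suc.prems by (simp add: F'_def)
      then have "Ck_on 0 ?B (\<lambda>z. F' z v)"
        by (induction k) (use Ck_on_SucD in blast)+
      then show ?thesis by simp
    qed
    \<comment> \<open>Differentiation under the integral asks for a derivative that is jointly
      continuous as a map into the bounded linear maps. In finite dimension it suffices to check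
      this on basis vectors.\<close>
    define L where "L = (\<lambda>z t. Blinfun (\<lambda>v. t ^ Suc m * F' (z0 + t *\<^sub>R (z - z0)) v))"
    have L: "blinfun_apply (L z t) v = t ^ Suc m * F' (z0 + t *\<^sub>R (z - z0)) v"
      if "z \<in> ?B" "t \<in> {0..1}" for z t v
    proof -
      have "bounded_linear (F' (z0 + t *\<^sub>R (z - z0)))"
        using F'[OF seg[OF that]] has_derivative_bounded_linear by blast
      then show ?thesis
        unfolding L_def by (simp add: bounded_linear_Blinfun_apply bounded_linear_const_mult)
    qed
    have contL: "continuous_on (?B \<times> {0..1}) (\<lambda>p. L (fst p) (snd p))"
    proof (rule continuous_on_blinfun_componentwise)
      fix i :: 'a assume "i \<in> Basis"
      show "continuous_on (?B \<times> {0..1}) (\<lambda>p. blinfun_apply (L (fst p) (snd p)) i)"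
        using contp[OF contF'[of i], of "Suc m"] by (rule continuous_on_eq) (auto simp: L)
    qed
    have der: "((\<lambda>z. integral {0..1} (\<lambda>t. t ^ m * F (z0 + t *\<^sub>R (z - z0)))) has_derivative
        (\<lambda>v. integral {0..1} (\<lambda>t. t ^ Suc m * F' (z0 + t *\<^sub>R (z - z0)) v))) (at z)"
      if z: "z \<in> ?B" for z
    proof -
      have "((\<lambda>z. integral (cbox 0 1) (\<lambda>t. t ^ m * F (z0 + t *\<^sub>R (z - z0)))) has_derivative
          blinfun_apply (integral (cbox 0 1) (L z))) (at z within ?B)"
      proof (rule leibniz_rule[OF _ _ _ z convex_ball])
        fix x t assume xt: "x \<in> ?B" "t \<in> cbox (0::real) 1"
        have "((\<lambda>x. F (z0 + t *\<^sub>R (x - z0))) has_derivative (\<lambda>v. F' (z0 + t *\<^sub>R (x - z0)) (t *\<^sub>R v)))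
            (at x within ?B)"
          by (rule has_derivative_compose[where f = "\<lambda>x. z0 + t *\<^sub>R (x - z0)" and g = F, OF _ F'[OF seg]])
            (use xt in \<open>auto intro!: derivative_eq_intros\<close>)
        moreover have "F' (z0 + t *\<^sub>R (x - z0)) (t *\<^sub>R v) = t * F' (z0 + t *\<^sub>R (x - z0)) v" for v
          using linear_cmul[OF has_derivative_linear[OF F'[OF seg]]] xt by simp
        ultimately have "((\<lambda>x. t ^ m * F (z0 + t *\<^sub>R (x - z0))) has_derivative
            (\<lambda>v. t ^ m * (t * F' (z0 + t *\<^sub>R (x - z0)) v))) (at x within ?B)"
          using has_derivative_mult_right by auto
        moreover have "blinfun_apply (L x t) = (\<lambda>v. t ^ m * (t * F' (z0 + t *\<^sub>R (x - z0)) v))"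
          using L xt by auto
        ultimately show "((\<lambda>x. t ^ m * F (z0 + t *\<^sub>R (x - z0))) has_derivative blinfun_apply (L x t))
            (at x within ?B)"
          by simp
      next
        show "(\<lambda>t. t ^ m * F (z0 + t *\<^sub>R (x - z0))) integrable_on cbox 0 1" if "x \<in> ?B" for x
          using int[OF contF that] by simp
        show "continuous_on (?B \<times> cbox 0 1) (\<lambda>(x, t). L x t)"
          using contL by (simp add: case_prod_unfold)
      qed
      moreover have "blinfun_apply (integral (cbox 0 1) (L z))
          = (\<lambda>v. integral {0..1} (\<lambda>t. t ^ Suc m * F' (z0 + t *\<^sub>R (z - z0)) v))"
      proof
        fix v
        have "continuous_on {0..1} (L z)"
          by (rule continuous_on_compose2[OF contL, of _ "Pair z", simplified])
            (use z in \<open>auto intro: continuous_intros\<close>)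
        then have "L z integrable_on {0..1}" by (rule integrable_continuous_interval)
        then have "blinfun_apply (integral {0..1} (L z)) v = integral {0..1} (\<lambda>t. blinfun_apply (L z t) v)"
          by (rule blinfun_apply_integral)
        also have "\<dots> = integral {0..1} (\<lambda>t. t ^ Suc m * F' (z0 + t *\<^sub>R (z - z0)) v)"
          using z by (intro integral_cong) (auto simp: L)
        finally show "blinfun_apply (integral (cbox 0 1) (L z)) v
            = integral {0..1} (\<lambda>t. t ^ Suc m * F' (z0 + t *\<^sub>R (z - z0)) v)"
          by (simp only: cbox_interval)
      qed
      ultimately show ?thesis
        by (simp only: cbox_interval at_within_open[OF z open_ball])
    qed
    show ?case
      using Suc.prems by (intro Ck_on_SucI[OF open_ball der] Suc.IH) (auto simp: F'_def)
  }
qed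

text \<open>Integrate the derivative of \<open>F\<close> along the segment from \<open>z0\<close> to
  \<open>z\<close> and expand the direction \<open>z - z0\<close> in the basis: \<open>G b z\<close>
  is the mean of the partial derivative in direction \<open>b\<close> over the segment.\<close>

lemma Hadamard:
  fixes F :: "'a::euclidean_space \<Rightarrow> real"
  assumes "smooth_on (ball z0 r) F" "0 < r"
  obtains G where "\<And>b. smooth_on (ball z0 r) (G b)"
    "\<And>b. G b z0 = frechet_derivative F (at z0) b"
    "\<And>z. z \<in> ball z0 r \<Longrightarrow> F z = F z0 + (\<Sum>b\<in>Basis. ((z - z0) \<bullet> b) * G b z)"
proof
  let ?B = "ball z0 r"
  define F' where "F' z = frechet_derivative F (at z)" for z
  define G where "G b z = integral {0..1} (\<lambda>t. t ^ 0 * F' (z0 + t *\<^sub>R (z - z0)) b)" for b z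
  have F': "(F has_derivative F' z) (at z)" if "z \<in> ?B" for z
    using smooth_on_differentiable[OF assms(1) that] frechet_derivative_works unfolding F'_def by auto
  show "smooth_on ?B (G b)" for b
    using smooth_on_frechet_derivative[OF assms(1), of b]
      Ck_on_integral_segment[of _ z0 r "\<lambda>z. F' z b" 0]
    unfolding smooth_on_def G_def F'_def by blast
  show "G b z0 = frechet_derivative F (at z0) b" for b
    by (simp add: G_def F'_def)
  show "F z = F z0 + (\<Sum>b\<in>Basis. ((z - z0) \<bullet> b) * G b z)" if z: "z \<in> ?B" for z
  proof -
    have seg: "z0 + t *\<^sub>R (z - z0) \<in> ?B" if "t \<in> {0..1}" for t
    proof -
      have "z0 + t *\<^sub>R (z - z0) = (1 - t) *\<^sub>R z0 + t *\<^sub>R z" by (simp add: algebra_simps)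
      then show ?thesis
        using convex_ball[of z0 r, unfolded convex_alt] that z assms(2) by auto
    qed
    have lin: "linear (F' (z0 + t *\<^sub>R (z - z0)))" if "t \<in> {0..1}" for t
      using has_derivative_linear[OF F'[OF seg[OF that]]] .
    have "((\<lambda>t. F (z0 + t *\<^sub>R (z - z0))) has_vector_derivative F' (z0 + t *\<^sub>R (z - z0)) (z - z0))
        (at t within {0..1})" if "t \<in> {0..1}" for t
    proof -
      have "((\<lambda>t. F (z0 + t *\<^sub>R (z - z0))) has_derivative (\<lambda>s. F' (z0 + t *\<^sub>R (z - z0)) (s *\<^sub>R (z - z0))))
          (at t within {0..1})"
        by (rule has_derivative_compose[where f = "\<lambda>t. z0 + t *\<^sub>R (z - z0)" and g = F,
            OF _ F'[OF seg[OF that]]]) (auto intro!: derivative_eq_intros)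
      then show ?thesis
        by (simp add: has_vector_derivative_def linear_cmul[OF lin[OF that]])
    qed
    then have "((\<lambda>t. F' (z0 + t *\<^sub>R (z - z0)) (z - z0)) has_integral
        (F (z0 + 1 *\<^sub>R (z - z0)) - F (z0 + 0 *\<^sub>R (z - z0)))) {0..1}"
      by (intro fundamental_theorem_of_calculus) auto
    then have "F z - F z0 = integral {0..1} (\<lambda>t. F' (z0 + t *\<^sub>R (z - z0)) (z - z0))"
      by (simp add: integral_unique)
    also have "\<dots> = integral {0..1} (\<lambda>t. \<Sum>b\<in>Basis. ((z - z0) \<bullet> b) * F' (z0 + t *\<^sub>R (z - z0)) b)"
    proof (rule integral_cong)
      fix t :: real assume "t \<in> {0..1}"
      then have "F' (z0 + t *\<^sub>R (z - z0)) (\<Sum>b\<in>Basis. ((z - z0) \<bullet> b) *\<^sub>R b)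
          = (\<Sum>b\<in>Basis. ((z - z0) \<bullet> b) *\<^sub>R F' (z0 + t *\<^sub>R (z - z0)) b)"
        using lin by (simp add: linear_sum linear_cmul)
      then show "F' (z0 + t *\<^sub>R (z - z0)) (z - z0)
          = (\<Sum>b\<in>Basis. ((z - z0) \<bullet> b) * F' (z0 + t *\<^sub>R (z - z0)) b)"
        by (simp add: euclidean_representation)
    qed
    also have "\<dots> = (\<Sum>b\<in>Basis. integral {0..1} (\<lambda>t. ((z - z0) \<bullet> b) * F' (z0 + t *\<^sub>R (z - z0)) b))"
    proof (rule integral_sum)
      fix b :: 'a
      have "continuous_on ?B (\<lambda>z. F' z b)"
        using smooth_on_continuous[OF smooth_on_frechet_derivative[OF assms(1)]] unfolding F'_def .
      then have "continuous_on {0..1} (\<lambda>t. F' (z0 + t *\<^sub>R (z - z0)) b)"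
        by (rule continuous_on_compose2) (intro continuous_intros, use seg in blast)
      then show "(\<lambda>t. ((z - z0) \<bullet> b) * F' (z0 + t *\<^sub>R (z - z0)) b) integrable_on {0..1}"
        by (intro integrable_continuous_interval continuous_on_mult_left)
    qed auto
    also have "\<dots> = (\<Sum>b\<in>Basis. ((z - z0) \<bullet> b) * G b z)"
      by (simp add: G_def)
    finally show ?thesis by simp
  qed
qed


section \<open>Smooth functions and tangent vectors on a manifold\<close>

lemma sum_fun_apply: "(\<Sum>i\<in>I. f i) x = (\<Sum>i\<in>I. f i x)"
  by (induction I rule: infinite_finite_induct) auto

lemma scaleR_fun_apply: "(r *\<^sub>R f) x = r *\<^sub>R f x"
  by (simp add: scaleR_fun_def)

lemma lin_on_add: "lin_on S h \<Longrightarrow> v \<in> S \<Longrightarrow> w \<in> S \<Longrightarrow> h (v + w) = h v + h w"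
  by (simp add: lin_on_def)

lemma lin_on_scaleR: "lin_on S h \<Longrightarrow> v \<in> S \<Longrightarrow> h (r *\<^sub>R v) = r *\<^sub>R h v"
  by (simp add: lin_on_def)

lemma lin_on_zero: "lin_on S h \<Longrightarrow> subspace S \<Longrightarrow> h 0 = 0"
  using lin_on_scaleR[of S h 0 0] by (simp add: subspace_0)

lemma lin_on_diff: "lin_on S h \<Longrightarrow> subspace S \<Longrightarrow> v \<in> S \<Longrightarrow> w \<in> S \<Longrightarrow> h (v - w) = h v - h w"
  using lin_on_add[of S h v "(-1) *\<^sub>R w"] lin_on_scaleR[of S h w "-1"]
  by (simp add: subspace_neg)

lemma lin_on_sum:
  assumes "lin_on S h" "subspace S" "\<And>i. i \<in> I \<Longrightarrow> v i \<in> S"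
  shows "h (\<Sum>i\<in>I. c i *\<^sub>R v i) = (\<Sum>i\<in>I. c i *\<^sub>R h (v i))"
  using assms(3)
proof (induction I rule: infinite_finite_induct)
  case (insert i I)
  have "(\<Sum>i\<in>I. c i *\<^sub>R v i) \<in> S"
    using insert.prems by (intro subspace_sum[OF assms(2)] subspace_scale[OF assms(2)]) auto
  then show ?case
    using insert by (simp add: lin_on_add[OF assms(1)] lin_on_scaleR[OF assms(1)]
        subspace_scale[OF assms(2)])
qed (auto simp: lin_on_zero[OF assms(1,2)])

section \<open>Charts and the algebra of smooth functions\<close>

locale manifold =
  fixes A :: "('m::{t2_space, second_countable_topology}, 'e::euclidean_space) chart set"
  assumes smooth_manifold: "smooth_manifold A"
begin

abbreviation "C \<equiv> smooth_functions A"
abbreviation "T \<equiv> tangent_space A"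
abbreviation "VF \<equiv> vector_fields A"
abbreviation "Om \<equiv> one_forms A"

lemma chart:
  assumes "(U, \<phi>) \<in> A"
  shows "open U" "open (\<phi> ` U)" "continuous_on U \<phi>" "continuous_on (\<phi> ` U) (inv_into U \<phi>)"
    "\<And>y. y \<in> U \<Longrightarrow> inv_into U \<phi> (\<phi> y) = y"
proof -
  have "is_chart (U, \<phi>)" using smooth_manifold assms by (auto simp: smooth_manifold_def)
  then show "open U" "open (\<phi> ` U)" "continuous_on U \<phi>" "continuous_on (\<phi> ` U) (inv_into U \<phi>)"
    "\<And>y. y \<in> U \<Longrightarrow> inv_into U \<phi> (\<phi> y) = y"
    by (auto simp: is_chart_def homeomorphism_def)
qed

lemma chart_at: obtains U \<phi> where "(U, \<phi>) \<in> A" "x \<in> U"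
  using smooth_manifold unfolding smooth_manifold_def by blast

lemma chart_transition:
  "(U, \<phi>) \<in> A \<Longrightarrow> (V, \<psi>) \<in> A \<Longrightarrow> smooth_on (\<phi> ` (U \<inter> V)) (\<lambda>z. \<psi> (inv_into U \<phi> z))"
  using smooth_manifold unfolding smooth_manifold_def comp_def by blast

lemma open_chart_image:
  assumes "(U, \<phi>) \<in> A" "open W"
  shows "open (\<phi> ` (U \<inter> W))"
proof -
  have "\<phi> ` (U \<inter> W) = \<phi> ` U \<inter> inv_into U \<phi> -` W"
    using chart(5)[OF assms(1)] by (force simp: inv_into_into)
  then show ?thesis
    using continuous_open_preimage[OF chart(4,2)[OF assms(1)] assms(2)] by simp
qed

lemma smooth_functions_iff:
  "f \<in> C \<longleftrightarrow> (\<forall>U \<phi>. (U, \<phi>) \<in> A \<longrightarrow> smooth_on (\<phi> ` U) (\<lambda>z. f (inv_into U \<phi> z)))"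
  by (auto simp: smooth_functions_def comp_def)

lemma smooth_functions_const: "(\<lambda>x. c) \<in> C"
  using chart(2) by (auto simp: smooth_functions_iff intro: smooth_on_const)

lemma smooth_functions_add: "f \<in> C \<Longrightarrow> h \<in> C \<Longrightarrow> (\<lambda>x. f x + h x) \<in> C"
  using chart(2) by (auto simp: smooth_functions_iff intro: smooth_on_add)

lemma smooth_functions_mult: "f \<in> C \<Longrightarrow> h \<in> C \<Longrightarrow> (\<lambda>x. f x * h x) \<in> C"
  using chart(2) by (auto simp: smooth_functions_iff intro: smooth_on_mult)

lemma smooth_functions_cmult: "f \<in> C \<Longrightarrow> (\<lambda>x. c * f x) \<in> C"
  by (intro smooth_functions_mult smooth_functions_const)

lemma smooth_functions_diff: "f \<in> C \<Longrightarrow> h \<in> C \<Longrightarrow> (\<lambda>x. f x - h x) \<in> C"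
  using smooth_functions_add[of f "\<lambda>x. (-1) * h x"] smooth_functions_cmult[of h "-1"] by simp

lemma smooth_functions_sum: "(\<And>i. i \<in> I \<Longrightarrow> f i \<in> C) \<Longrightarrow> (\<lambda>x. \<Sum>i\<in>I. f i x) \<in> C"
  by (induction I rule: infinite_finite_induct)
    (auto intro: smooth_functions_const smooth_functions_add)

lemma smooth_functions_prod: "(\<And>i. i \<in> I \<Longrightarrow> f i \<in> C) \<Longrightarrow> (\<lambda>x. \<Prod>i\<in>I. f i x) \<in> C"
  by (induction I rule: infinite_finite_induct)
    (auto intro: smooth_functions_const smooth_functions_mult)

lemma smooth_functions_det:
  fixes M :: "'n::finite \<Rightarrow> 'n \<Rightarrow> 'm \<Rightarrow> real"
  assumes "\<And>i j. M i j \<in> C"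
  shows "(\<lambda>x. det (\<chi> i j. M i j x)) \<in> C"
proof -
  have "(\<lambda>x. \<Sum>p | p permutes UNIV. of_int (sign p) * (\<Prod>i\<in>UNIV. M i (p i) x)) \<in> C"
    by (rule smooth_functions_sum, rule smooth_functions_cmult, rule smooth_functions_prod, rule assms)
  then show ?thesis by (simp add: det_def)
qed

lemma subspace_smooth_functions: "subspace C"
  using smooth_functions_const[of 0]
  by (auto simp: subspace_def zero_fun_def plus_fun_def scaleR_fun_def
      intro: smooth_functions_add smooth_functions_cmult)

text \<open>This is the form in which Cramer's rule delivers its solutions: numerator and
  denominator are globally smooth, but the denominator is known to be nonzero only near the given
  point.\<close>

lemma smooth_functions_local_quotient:
  assumes "\<And>x. \<exists>W N \<delta>. open W \<and> x \<in> W \<and> N \<in> C \<and> \<delta> \<in> C \<and> (\<forall>y\<in>W. \<delta> y \<noteq> 0 \<and> u y = N y / \<delta> y)"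
  shows "u \<in> C"
  unfolding smooth_functions_iff
proof (intro allI impI, rule smooth_on_local)
  fix V \<psi> z assume V: "(V, \<psi>) \<in> A" and "z \<in> \<psi> ` V"
  then obtain x where x: "x \<in> V" "z = \<psi> x" by blast
  obtain W N \<delta> where W: "open W" "x \<in> W" "N \<in> C" "\<delta> \<in> C"
    and quot: "\<forall>y\<in>W. \<delta> y \<noteq> 0 \<and> u y = N y / \<delta> y"
    using assms[of x] by (elim exE conjE)
  let ?S = "\<psi> ` (V \<inter> W)" and ?i = "inv_into V \<psi>"
  have S: "open ?S" using open_chart_image[OF V W(1)] .
  have inW: "?i w \<in> W" if "w \<in> ?S" for w
    using that chart(5)[OF V] by auto
  have "smooth_on ?S (\<lambda>w. N (?i w))" "smooth_on ?S (\<lambda>w. \<delta> (?i w))"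
    using W(3,4) V smooth_on_subset[of "\<psi> ` V" _ ?S] unfolding smooth_functions_iff by blast+
  then have "smooth_on ?S (\<lambda>w. N (?i w) / \<delta> (?i w))"
    using inW quot by (intro smooth_on_divide[OF S]) auto
  then have "smooth_on ?S (\<lambda>w. u (?i w))"
    using smooth_on_cong[OF S, of "\<lambda>w. u (?i w)" "\<lambda>w. N (?i w) / \<delta> (?i w)"] inW quot by blast
  then show "\<exists>S. open S \<and> z \<in> S \<and> smooth_on S (\<lambda>w. u (?i w))"
    using S x W(2) by blast
qed

text \<open>Two open sets cover the manifold: the part of \<open>U\<close> mapped into
  \<open>W\<close>, where smoothness follows from chart transitions, and the complement of the
  preimage of \<open>K\<close>, where the function vanishes. The latter is open because compact sets
  are closed in a Hausdorff space.\<close>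

lemma extend_by_zero:
  assumes U: "(U, \<phi>) \<in> A" and W: "open W" "W \<subseteq> \<phi> ` U"
    and K: "compact K" "K \<subseteq> W"
    and u: "smooth_on W u" "\<And>z. z \<in> W - K \<Longrightarrow> u z = 0"
  shows "(\<lambda>y. if y \<in> U \<and> \<phi> y \<in> W then u (\<phi> y) else 0) \<in> C" (is "?e \<in> C")
  unfolding smooth_functions_iff
proof (intro allI impI, rule smooth_on_local)
  fix V \<psi> z assume V: "(V, \<psi>) \<in> A" and "z \<in> \<psi> ` V"
  then obtain x where x: "x \<in> V" "z = \<psi> x" by blast
  let ?i = "inv_into V \<psi>"
  show "\<exists>S. open S \<and> z \<in> S \<and> smooth_on S (\<lambda>w. ?e (?i w))"
  proof (cases "x \<in> U \<and> \<phi> x \<in> W")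
    case True
    let ?Q = "U \<inter> \<phi> -` W" and ?S = "\<psi> ` (V \<inter> (U \<inter> \<phi> -` W))"
    have "open ?Q" using continuous_open_preimage[OF chart(3,1)[OF U] W(1)] .
    then have S: "open ?S" using open_chart_image[OF V] by blast
    have inQ: "?i w \<in> ?Q" if "w \<in> ?S" for w
      using that chart(5)[OF V] by auto
    have "smooth_on ?S (\<lambda>w. \<phi> (?i w))"
      using chart_transition[OF V U] smooth_on_subset[of _ _ ?S] by blast
    then have "smooth_on ?S (\<lambda>w. u (\<phi> (?i w)))"
      using smooth_on_compose[OF S _ u(1)] inQ by blast
    then have "smooth_on ?S (\<lambda>w. ?e (?i w))"
      using smooth_on_cong[OF S, of "\<lambda>w. ?e (?i w)" "\<lambda>w. u (\<phi> (?i w))"] inQ by simp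
    then show ?thesis using S x True by blast
  next
    case False
    let ?K = "inv_into U \<phi> ` K" and ?S = "\<psi> ` (V \<inter> - (inv_into U \<phi> ` K))"
    have "compact ?K"
      using K W(2) continuous_on_subset[OF chart(4)[OF U]] by (intro compact_continuous_image) auto
    then have S: "open ?S"
      using open_chart_image[OF V] compact_imp_closed by blast
    have "x \<notin> ?K"
    proof
      assume "x \<in> ?K"
      then obtain k where k: "k \<in> K" "x = inv_into U \<phi> k" by blast
      then have "k \<in> \<phi> ` U" using K W by blast
      then have "x \<in> U" "\<phi> x = k" using k by (auto simp: inv_into_into f_inv_into_f)
      then show False using False k K by blast
    qed
    have zero: "?e (?i w) = 0" if w: "w \<in> ?S" for w
    proof -
      obtain y where y: "y \<in> V" "y \<notin> ?K" "w = \<psi> y" using w by blast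
      have iw: "?i w = y" using y(1,3) chart(5)[OF V] by simp
      have "\<phi> y \<notin> K" if "y \<in> U" using y(2) chart(5)[OF U that] by force
      then show ?thesis using u(2) iw by auto
    qed
    then have "smooth_on ?S (\<lambda>w. ?e (?i w))"
      using smooth_on_cong[OF S, of "\<lambda>w. ?e (?i w)" "\<lambda>w. 0"] smooth_on_const[OF S, of "0::real"] by blast
    then show ?thesis using S x \<open>x \<notin> ?K\<close> by blast
  qed
qed

text \<open>The device that makes local functions global: \<open>h\<close> vanishes outside the ball
  of radius \<open>r / 2\<close>, so for any \<open>u\<close> smooth on the ball of radius
  \<open>r\<close> the product \<open>h * u\<close> vanishes off the compact
  \<open>cball (\<phi> x) (r / 2)\<close> and extends by zero.\<close>

lemma chart_bump:
  assumes U: "(U, \<phi>) \<in> A" and x: "x \<in> U"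
  obtains r h where "0 < r" "ball (\<phi> x) r \<subseteq> \<phi> ` U" "smooth_on UNIV h" "h (\<phi> x) = (1::real)"
    "\<And>z. z \<in> ball (\<phi> x) (r / 2) \<Longrightarrow> h z > 0"
    "\<And>u. smooth_on (ball (\<phi> x) r) u \<Longrightarrow>
      (\<lambda>y. if y \<in> U \<and> \<phi> y \<in> ball (\<phi> x) r then h (\<phi> y) * u (\<phi> y) else 0) \<in> C"
proof -
  obtain r where r: "0 < r" "ball (\<phi> x) r \<subseteq> \<phi> ` U"
    using chart(2)[OF U] x openE[of "\<phi> ` U" "\<phi> x"] by blast
  obtain h :: "'e \<Rightarrow> real" where h: "smooth_on UNIV h" "h (\<phi> x) = 1"
    "\<And>z. z \<in> ball (\<phi> x) (r / 2) \<Longrightarrow> h z > 0" "\<And>z. z \<notin> ball (\<phi> x) (r / 2) \<Longrightarrow> h z = 0"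
    using smooth_bump[of "r / 2" "\<phi> x"] r(1) by auto
  have "(\<lambda>y. if y \<in> U \<and> \<phi> y \<in> ball (\<phi> x) r then h (\<phi> y) * u (\<phi> y) else 0) \<in> C"
    if "smooth_on (ball (\<phi> x) r) u" for u
    by (rule extend_by_zero[OF U open_ball r(2) compact_cball, of "\<phi> x" "r / 2" "\<lambda>z. h z * u z"])
      (use r(1) h that in \<open>auto intro!: smooth_on_mult intro: smooth_on_subset\<close>)
  then show ?thesis using r h(1-3) that by blast
qed

section \<open>Derivations at a point and coordinate vectors\<close>

lemma tangent_lin_on: "v \<in> T x \<Longrightarrow> lin_on C v"
  by (simp add: tangent_space_def)

lemma tangent_mult:
  assumes "v \<in> T x" "f \<in> C" "h \<in> C"
  shows "v (\<lambda>y. f y * h y) = f x * v h + h x * v f"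
proof -
  have "v (f * h) = f x * v h + h x * v f" using assms by (simp add: tangent_space_def)
  then show ?thesis by (simp only: times_fun_def)
qed

lemma tangent_nonsmooth: "v \<in> T x \<Longrightarrow> f \<notin> C \<Longrightarrow> v f = 0"
  by (simp add: tangent_space_def)

lemma tangent_add: "v \<in> T x \<Longrightarrow> f \<in> C \<Longrightarrow> h \<in> C \<Longrightarrow> v (\<lambda>y. f y + h y) = v f + v h"
  using lin_on_add[OF tangent_lin_on, of v x f h] by (simp add: plus_fun_def)

lemma tangent_cmult: "v \<in> T x \<Longrightarrow> f \<in> C \<Longrightarrow> v (\<lambda>y. c * f y) = c * v f"
  using lin_on_scaleR[OF tangent_lin_on, of v x f c] by (simp add: scaleR_fun_def)

lemma tangent_diff: "v \<in> T x \<Longrightarrow> f \<in> C \<Longrightarrow> h \<in> C \<Longrightarrow> v (\<lambda>y. f y - h y) = v f - v h"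
  using lin_on_diff[OF tangent_lin_on subspace_smooth_functions, of v x f h] by (simp add: fun_diff_def)

lemma tangent_const:
  assumes "v \<in> T x"
  shows "v (\<lambda>y. c) = 0"
proof -
  \<comment> \<open>The product rule for \<open>1 * 1\<close> gives
    \<open>v 1 = 2 * v 1\<close>.\<close>
  have "v (\<lambda>y. 1 * 1) = 1 * v (\<lambda>y. 1) + 1 * v (\<lambda>y. 1)"
    by (rule tangent_mult[OF assms]) (rule smooth_functions_const)+
  then have "v (\<lambda>y. 1) = 0" by simp
  then show ?thesis using tangent_cmult[OF assms smooth_functions_const, of c 1] by simp
qed

lemma tangent_sum:
  "v \<in> T x \<Longrightarrow> (\<And>i. i \<in> I \<Longrightarrow> f i \<in> C) \<Longrightarrow> v (\<lambda>y. \<Sum>i\<in>I. f i y) = (\<Sum>i\<in>I. v (f i))"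
proof (induction I rule: infinite_finite_induct)
  case (insert i I)
  then show ?case
    using tangent_add[OF insert.prems(1), of "f i" "\<lambda>y. \<Sum>i\<in>I. f i y"]
    by (simp add: smooth_functions_sum)
qed (auto simp: tangent_const)

lemma subspace_tangent_space: "subspace (T x)"
  unfolding subspace_def
proof (intro conjI ballI allI)
  show "0 \<in> T x" by (simp add: tangent_space_def lin_on_def)
  show "v + w \<in> T x" if "v \<in> T x" "w \<in> T x" for v w
    using that by (auto simp: tangent_space_def lin_on_def algebra_simps)
  show "c *\<^sub>R v \<in> T x" if "v \<in> T x" for c v
    using that by (auto simp: tangent_space_def lin_on_def scaleR_fun_def algebra_simps)
qed

text \<open>The coordinate derivation at \<open>x\<close> in direction \<open>b\<close>: the partial
  derivative of \<open>f\<close> read in the chart. The value 0 off \<open>C\<close> follows the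
  convention for tangent vectors.\<close>

definition coord_vec :: "'m set \<Rightarrow> ('m \<Rightarrow> 'e) \<Rightarrow> 'm \<Rightarrow> 'e \<Rightarrow> 'm tvec" where
  "coord_vec U \<phi> x b f =
     (if f \<in> C then frechet_derivative (\<lambda>z. f (inv_into U \<phi> z)) (at (\<phi> x)) b else 0)"

lemma coord_vec_tangent:
  assumes U: "(U, \<phi>) \<in> A" and x: "x \<in> U"
  shows "coord_vec U \<phi> x b \<in> T x"
proof -
  let ?i = "inv_into U \<phi>"
  have der: "((\<lambda>z. f (?i z)) has_derivative frechet_derivative (\<lambda>z. f (?i z)) (at (\<phi> x))) (at (\<phi> x))"
    if "f \<in> C" for f
    using that U x smooth_on_differentiable[of "\<phi> ` U" "\<lambda>z. f (?i z)" "\<phi> x"]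
    by (simp add: smooth_functions_iff frechet_derivative_works)
  have 1: "coord_vec U \<phi> x b f = f' b"
    if "f \<in> C" "((\<lambda>z. f (?i z)) has_derivative f') (at (\<phi> x))" for f f'
    using frechet_derivative_at[OF that(2)] that(1) by (simp add: coord_vec_def)
  have "coord_vec U \<phi> x b (f + h) = coord_vec U \<phi> x b f + coord_vec U \<phi> x b h"
    if "f \<in> C" "h \<in> C" for f h
    using 1[of "\<lambda>y. f y + h y", OF smooth_functions_add[OF that]
        has_derivative_add[OF der[OF that(1)] der[OF that(2)]]] that
    by (simp add: coord_vec_def plus_fun_def)
  moreover have "coord_vec U \<phi> x b (r *\<^sub>R f) = r * coord_vec U \<phi> x b f" if "f \<in> C" for f r
    using 1[of "\<lambda>y. r * f y", OF smooth_functions_cmult[OF that] has_derivative_mult_right[OF der[OF that]]] that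
    by (simp add: coord_vec_def scaleR_fun_def)
  moreover have "coord_vec U \<phi> x b (f * h) = f x * coord_vec U \<phi> x b h + h x * coord_vec U \<phi> x b f"
    if "f \<in> C" "h \<in> C" for f h
    using 1[of "\<lambda>y. f y * h y", OF smooth_functions_mult[OF that]
        has_derivative_mult[OF der[OF that(1)] der[OF that(2)]]] that chart(5)[OF U x]
    by (simp add: coord_vec_def times_fun_def)
  ultimately show ?thesis
    by (auto simp: tangent_space_def lin_on_def coord_vec_def)
qed

text \<open>By Hadamard's lemma \<open>f - f x\<close> is locally a sum of products of coordinate
  functions vanishing at \<open>x\<close> with functions whose values at \<open>x\<close> are the
  partial derivatives. A derivation at \<open>x\<close> sees only those values, so it is determined
  by what it does to the coordinates.\<close>

lemma tangent_coord:
  assumes U: "(U, \<phi>) \<in> A" and x: "x \<in> U" and v: "v \<in> T x"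
  shows "\<exists>c. v = (\<Sum>b\<in>Basis. c b *\<^sub>R coord_vec U \<phi> x b)"
proof -
  let ?i = "inv_into U \<phi>"
  obtain r h where r: "0 < r" "ball (\<phi> x) r \<subseteq> \<phi> ` U" and h: "smooth_on UNIV h" "h (\<phi> x) = (1::real)"
    and hpos: "\<And>z. z \<in> ball (\<phi> x) (r / 2) \<Longrightarrow> h z > 0"
    and ext: "\<And>u. smooth_on (ball (\<phi> x) r) u \<Longrightarrow>
      (\<lambda>y. if y \<in> U \<and> \<phi> y \<in> ball (\<phi> x) r then h (\<phi> y) * u (\<phi> y) else 0) \<in> C"
    by (rule chart_bump[OF U x], rule that)
  \<comment> \<open>\<open>e u\<close> is \<open>u\<close> cut off by the bump and transported to
    the manifold; \<open>e (\<lambda>z. 1)\<close> is the bump itself, and \<open>X b\<close> below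
    is a cut-off coordinate centred at \<open>x\<close>.\<close>
  define e where "e u y = (if y \<in> U \<and> \<phi> y \<in> ball (\<phi> x) r then h (\<phi> y) * u (\<phi> y) else 0)" for u y
  have e: "e u \<in> C" if "smooth_on (ball (\<phi> x) r) u" for u
    using ext[OF that] unfolding e_def[abs_def] .
  have ex: "e u x = u (\<phi> x)" for u
    using x r(1) h(2) by (simp add: e_def)
  define X where "X b = e (\<lambda>z. (z - \<phi> x) \<bullet> b)" for b
  have X: "X b \<in> C" for b
  proof -
    have "smooth_on (ball (\<phi> x) r) (\<lambda>z. z \<bullet> b + (- (\<phi> x \<bullet> b)))"
      by (intro smooth_on_add smooth_on_const smooth_on_bounded_linear bounded_linear_inner_left) auto
    then show ?thesis unfolding X_def by (intro e) (simp add: inner_diff_left)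
  qed
  have Xx: "X b x = 0" for b by (simp add: X_def ex)
  have \<chi>: "e (\<lambda>z. 1) \<in> C" by (intro e smooth_on_const) simp
  have smooth: "v f = (\<Sum>b\<in>Basis. v (X b) * coord_vec U \<phi> x b f)" if f: "f \<in> C" for f
  proof -
    have F: "smooth_on (ball (\<phi> x) r) (\<lambda>z. f (?i z))"
      using f U r(2) smooth_on_subset unfolding smooth_functions_iff by blast
    obtain G where G: "\<And>b. smooth_on (ball (\<phi> x) r) (G b)"
      "\<And>b. G b (\<phi> x) = frechet_derivative (\<lambda>z. f (?i z)) (at (\<phi> x)) b"
      "\<And>z. z \<in> ball (\<phi> x) r \<Longrightarrow> f (?i z) = f (?i (\<phi> x)) + (\<Sum>b\<in>Basis. ((z - \<phi> x) \<bullet> b) * G b z)"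
      by (rule Hadamard[OF F r(1)], rule that)
    have H: "e (G b) \<in> C" for b using e G(1) by blast
    \<comment> \<open>Both factors on the right carry a bump, so the left side carries its square.
      At \<open>x\<close> the bump is 1, while \<open>f y - f x\<close> and \<open>X b\<close>
      vanish: the product rule reduces the left side to \<open>v f\<close> and each summand on the
      right to \<open>v (X b)\<close> times a partial derivative of \<open>f\<close>.\<close>
    have "e (\<lambda>z. 1) y * e (\<lambda>z. 1) y * (f y - f x) = (\<Sum>b\<in>Basis. X b y * e (G b) y)" for y
    proof (cases "y \<in> U \<and> \<phi> y \<in> ball (\<phi> x) r")
      case True
      have "f y - f x = (\<Sum>b\<in>Basis. ((\<phi> y - \<phi> x) \<bullet> b) * G b (\<phi> y))"
        using G(3)[of "\<phi> y"] True chart(5)[OF U] x by simp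
      then show ?thesis
        using True by (simp add: X_def e_def sum_distrib_left algebra_simps)
    qed (auto simp: X_def e_def)
    then have "v (\<lambda>y. (e (\<lambda>z. 1) y * e (\<lambda>z. 1) y) * (f y - f x)) = v (\<lambda>y. \<Sum>b\<in>Basis. X b y * e (G b) y)"
      by presburger
    moreover have "v (\<lambda>y. (e (\<lambda>z. 1) y * e (\<lambda>z. 1) y) * (f y - f x)) = v f"
      using tangent_mult[OF v smooth_functions_mult[OF \<chi> \<chi>]
          smooth_functions_diff[OF f smooth_functions_const]]
      by (simp add: ex tangent_diff[OF v f smooth_functions_const] tangent_const[OF v])
    moreover have "v (\<lambda>y. \<Sum>b\<in>Basis. X b y * e (G b) y) = (\<Sum>b\<in>Basis. v (\<lambda>y. X b y * e (G b) y))"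
      by (intro tangent_sum[OF v] smooth_functions_mult X H)
    moreover have "v (\<lambda>y. X b y * e (G b) y) = v (X b) * coord_vec U \<phi> x b f" for b
      using f by (simp add: tangent_mult[OF v X H] Xx ex G(2) coord_vec_def mult.commute)
    ultimately show ?thesis by simp
  qed
  have all: "v f = (\<Sum>b\<in>Basis. v (X b) * coord_vec U \<phi> x b f)" for f
  proof (cases "f \<in> C")
    case False
    then show ?thesis using tangent_nonsmooth[OF v False] by (simp add: coord_vec_def)
  qed (rule smooth)
  have "v = (\<Sum>b\<in>Basis. v (X b) *\<^sub>R coord_vec U \<phi> x b)"
    by (rule HOL.ext) (unfold sum_fun_apply scaleR_fun_apply real_scaleR_def, rule all)
  then show ?thesis by (rule exI[of _ "\<lambda>b. v (X b)"])
qed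

text \<open>The cut-off coordinate in direction \<open>b\<close> separates the coordinate vectors:
  at \<open>\<phi> x\<close> the bump is 1 and the centred coordinate is 0, so the derivative of the
  bump drops out and the product has derivative \<open>w \<bullet> b\<close>.\<close>

lemma coord_vec_independent:
  assumes U: "(U, \<phi>) \<in> A" and x: "x \<in> U"
    and c: "(\<Sum>b\<in>Basis. c b *\<^sub>R coord_vec U \<phi> x b) = 0" and b: "b \<in> Basis"
  shows "c b = 0"
proof -
  let ?i = "inv_into U \<phi>"
  obtain r h where r: "0 < r" "ball (\<phi> x) r \<subseteq> \<phi> ` U" and h: "smooth_on UNIV h" "h (\<phi> x) = (1::real)"
    and hpos: "\<And>z. z \<in> ball (\<phi> x) (r / 2) \<Longrightarrow> h z > 0"
    and ext: "\<And>u. smooth_on (ball (\<phi> x) r) u \<Longrightarrow>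
      (\<lambda>y. if y \<in> U \<and> \<phi> y \<in> ball (\<phi> x) r then h (\<phi> y) * u (\<phi> y) else 0) \<in> C"
    by (rule chart_bump[OF U x], rule that)
  define X where "X y = (if y \<in> U \<and> \<phi> y \<in> ball (\<phi> x) r then h (\<phi> y) * (\<phi> y \<bullet> b + (- (\<phi> x \<bullet> b))) else 0)" for y
  have X: "X \<in> C"
    unfolding X_def[abs_def]
    by (intro ext smooth_on_add smooth_on_const smooth_on_bounded_linear bounded_linear_inner_left) auto
  obtain h' where h': "(h has_derivative h') (at (\<phi> x))"
    using smooth_on_differentiable[OF h(1)] by (auto simp: differentiable_def)
  have "((\<lambda>z. h z * (z \<bullet> b + (- (\<phi> x \<bullet> b)))) has_derivative (\<lambda>w. w \<bullet> b)) (at (\<phi> x))"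
    using h(2) by (auto intro!: derivative_eq_intros h')
  then have "((\<lambda>z. X (?i z)) has_derivative (\<lambda>w. w \<bullet> b)) (at (\<phi> x))"
  proof (rule has_derivative_transform_within_open[of _ _ _ _ "ball (\<phi> x) r"])
    fix z assume z: "z \<in> ball (\<phi> x) r"
    then have "?i z \<in> U" "\<phi> (?i z) = z" using r(2) by (auto simp: inv_into_into f_inv_into_f)
    then show "h z * (z \<bullet> b + (- (\<phi> x \<bullet> b))) = X (?i z)" using z by (simp add: X_def)
  qed (use r(1) in auto)
  then have "coord_vec U \<phi> x b' X = b' \<bullet> b" for b'
    using X frechet_derivative_at by (metis (no_types, lifting) coord_vec_def)
  then have "(\<Sum>b'\<in>Basis. c b' *\<^sub>R coord_vec U \<phi> x b') X = (\<Sum>b'\<in>Basis. c b' * (b' \<bullet> b))"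
    by (simp add: sum_fun_apply scaleR_fun_apply)
  also have "\<dots> = (\<Sum>b'\<in>Basis. if b' = b then c b' else 0)"
    using b by (intro sum.cong) (auto simp: inner_Basis)
  also have "\<dots> = c b"
    using b by simp
  finally show ?thesis using c by simp
qed


section \<open>Vector fields and 1-forms\<close>

lemma vector_fields_tangent: "X \<in> VF \<Longrightarrow> X x \<in> T x"
  by (simp add: vector_fields_def)

lemma vf_apply_smooth: "X \<in> VF \<Longrightarrow> f \<in> C \<Longrightarrow> vf_apply X f \<in> C"
  by (simp add: vector_fields_def)

lemma subspace_vector_fields: "subspace VF"
  unfolding subspace_def
proof (intro conjI ballI allI)
  show "0 \<in> VF"
    using subspace_0[OF subspace_tangent_space] smooth_functions_const[of 0]
    by (simp add: vector_fields_def vf_apply_def)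
  show "X + Y \<in> VF" if "X \<in> VF" "Y \<in> VF" for X Y
    using that subspace_add[OF subspace_tangent_space]
    by (simp add: vector_fields_def vf_apply_def smooth_functions_add)
  show "c *\<^sub>R X \<in> VF" if "X \<in> VF" for c X
    using that subspace_scale[OF subspace_tangent_space]
    by (simp add: vector_fields_def vf_apply_def scaleR_fun_def smooth_functions_cmult)
qed

text \<open>The frame consists of coordinate fields multiplied by the bump and extended by zero.
  They are global, and on \<open>W\<close> the bump is positive, so rescaling by it affects neither
  spanning nor independence.\<close>

lemma local_frame:
  obtains E W where "open W" "x \<in> W" "\<And>b. E b \<in> VF"
    "\<And>y v. y \<in> W \<Longrightarrow> v \<in> T y \<Longrightarrow> \<exists>c. v = (\<Sum>b\<in>Basis. c b *\<^sub>R E (b::'e) y)"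
    "\<And>y c b. y \<in> W \<Longrightarrow> (\<Sum>b\<in>Basis. c b *\<^sub>R E b y) = 0 \<Longrightarrow> b \<in> Basis \<Longrightarrow> c b = 0"
proof -
  obtain U \<phi> where U: "(U, \<phi>) \<in> A" and x: "x \<in> U" using chart_at by blast
  obtain r h where r: "0 < r" "ball (\<phi> x) r \<subseteq> \<phi> ` U" and h: "smooth_on UNIV h" "h (\<phi> x) = (1::real)"
    and hpos: "\<And>z. z \<in> ball (\<phi> x) (r / 2) \<Longrightarrow> h z > 0"
    and ext: "\<And>u. smooth_on (ball (\<phi> x) r) u \<Longrightarrow>
      (\<lambda>y. if y \<in> U \<and> \<phi> y \<in> ball (\<phi> x) r then h (\<phi> y) * u (\<phi> y) else 0) \<in> C"
    by (rule chart_bump[OF U x], rule that)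
  define E where "E b y = (if y \<in> U \<and> \<phi> y \<in> ball (\<phi> x) r then h (\<phi> y) *\<^sub>R coord_vec U \<phi> y b else 0)" for b y
  define W where "W = U \<inter> \<phi> -` ball (\<phi> x) (r / 2)"
  have EW: "E b y = h (\<phi> y) *\<^sub>R coord_vec U \<phi> y b" and hW: "h (\<phi> y) > 0" if "y \<in> W" for y b
    using that hpos r(1) by (auto simp: E_def W_def)
  show ?thesis
  proof
    show "open W"
      unfolding W_def using continuous_open_preimage[OF chart(3,1)[OF U] open_ball] .
    show "x \<in> W" using x r(1) by (simp add: W_def)
    show "E b \<in> VF" for b
      unfolding vector_fields_def
    proof (intro CollectI conjI allI ballI)
      show "E b y \<in> T y" for y
        using coord_vec_tangent[OF U] by (simp add: E_def subspace_tangent_space subspace_scale subspace_0)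
      fix f assume f: "f \<in> C"
      have "smooth_on (ball (\<phi> x) r) (\<lambda>z. frechet_derivative (\<lambda>z. f (inv_into U \<phi> z)) (at z) b)"
        using f U r(2) smooth_on_subset smooth_on_frechet_derivative unfolding smooth_functions_iff by blast
      moreover have "vf_apply (E b) f = (\<lambda>y. if y \<in> U \<and> \<phi> y \<in> ball (\<phi> x) r
          then h (\<phi> y) * frechet_derivative (\<lambda>z. f (inv_into U \<phi> z)) (at (\<phi> y)) b else 0)"
        using f by (auto simp: fun_eq_iff vf_apply_def E_def scaleR_fun_apply coord_vec_def)
      ultimately show "vf_apply (E b) f \<in> C" using ext by simp
    qed
    show "\<exists>c. v = (\<Sum>b\<in>Basis. c b *\<^sub>R E b y)" if y: "y \<in> W" and v: "v \<in> T y" for y v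
    proof -
      obtain c where "v = (\<Sum>b\<in>Basis. c b *\<^sub>R coord_vec U \<phi> y b)"
        using tangent_coord[OF U _ v] y by (auto simp: W_def)
      then have "v = (\<Sum>b\<in>Basis. (c b / h (\<phi> y)) *\<^sub>R E b y)"
        using hW[OF y] by (simp add: EW[OF y])
      then show ?thesis by (intro exI[of _ "\<lambda>b. c b / h (\<phi> y)"])
    qed
    show "c b = 0" if y: "y \<in> W" and "(\<Sum>b\<in>Basis. c b *\<^sub>R E b y) = 0" "b \<in> Basis" for y c b
    proof -
      have "c b * h (\<phi> y) = 0"
        using that coord_vec_independent[OF U, of y "\<lambda>b. c b * h (\<phi> y)" b] by (simp add: EW[OF y] W_def)
      then show ?thesis using hW[OF y] by simp
    qed
  qed
qed

text \<open>Since the frame fields are global, their combination with constant coefficients is a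
  global field. This is how identities for fields are turned into identities at a point.\<close>

lemma extend_tangent_vector:
  assumes v: "v \<in> T x"
  obtains Z where "Z \<in> VF" "Z x = v"
proof -
  obtain E W where "x \<in> W" and E: "\<And>b. E b \<in> VF"
    and span: "\<And>y v. y \<in> W \<Longrightarrow> v \<in> T y \<Longrightarrow> \<exists>c. v = (\<Sum>b\<in>Basis. c b *\<^sub>R E (b::'e) y)"
    by (rule local_frame[of x], rule that)
  then obtain c where c: "v = (\<Sum>b\<in>Basis. c b *\<^sub>R E b x)"
    using v by blast
  show ?thesis
  proof
    show "(\<Sum>b\<in>Basis. c b *\<^sub>R E b) \<in> VF"
      using E by (intro subspace_sum subspace_scale subspace_vector_fields)
    show "(\<Sum>b\<in>Basis. c b *\<^sub>R E b) x = v"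
      by (simp add: c sum_fun_apply scaleR_fun_apply)
  qed
qed

text \<open>On a tangent vector, evaluate on a global field through it; elsewhere both covectors are
  0 by convention. This provides the uniqueness required by the definite description in
  \<open>form_connection\<close>.\<close>

lemma one_form_eqI:
  assumes "\<alpha> \<in> Om" "\<beta> \<in> Om" "\<And>Z. Z \<in> VF \<Longrightarrow> form_apply \<alpha> Z = form_apply \<beta> Z"
  shows "\<alpha> = \<beta>"
proof (intro ext)
  fix x v
  have cot: "\<alpha> x \<in> cotangent_space A x" "\<beta> x \<in> cotangent_space A x"
    using assms(1,2) by (auto simp: one_forms_def)
  show "\<alpha> x v = \<beta> x v"
  proof (cases "v \<in> T x")
    case True
    then obtain Z where Z: "Z \<in> VF" "Z x = v" using extend_tangent_vector by blast
    then show ?thesis using fun_cong[OF assms(3)[OF Z(1)], of x] by (simp add: form_apply_def)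
  next
    case False
    then show ?thesis using cot by (simp add: cotangent_space_def)
  qed
qed

text \<open>In the product rule for the commutator the cross terms \<open>X f * Y h\<close> and
  \<open>X h * Y f\<close> each occur twice with opposite signs, so the second-order operator is
  again a derivation. On non-smooth functions both iterated derivatives are those of the zero
  function.\<close>

lemma lie_bracket_vector_field:
  assumes X: "X \<in> VF" and Y: "Y \<in> VF"
  shows "lie_bracket X Y \<in> VF"
  unfolding vector_fields_def
proof (intro CollectI conjI allI ballI)
  note XT = vector_fields_tangent[OF X] and YT = vector_fields_tangent[OF Y]
    and XC = vf_apply_smooth[OF X] and YC = vf_apply_smooth[OF Y]
  fix x
  let ?L = "lie_bracket X Y x"
  have app: "vf_apply Z (\<lambda>y. f y + h y) = (\<lambda>y. vf_apply Z f y + vf_apply Z h y)"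
    "vf_apply Z (\<lambda>y. c * f y) = (\<lambda>y. c * vf_apply Z f y)"
    "vf_apply Z (\<lambda>y. f y * h y) = (\<lambda>y. f y * vf_apply Z h y + h y * vf_apply Z f y)"
    if "Z \<in> VF" "f \<in> C" "h \<in> C" for Z f h c
    using that vector_fields_tangent[OF that(1)]
    by (simp_all add: vf_apply_def tangent_add[OF vector_fields_tangent] tangent_cmult[OF vector_fields_tangent]
        tangent_mult[OF vector_fields_tangent])
  show "?L \<in> T x"
    unfolding tangent_space_def lin_on_def
  proof (intro CollectI conjI allI ballI impI)
    show "?L (f + h) = ?L f + ?L h" if "f \<in> C" "h \<in> C" for f h
      using that
      by (simp add: lie_bracket_def plus_fun_def app[OF X] app[OF Y] tangent_add[OF XT] tangent_add[OF YT] XC YC)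
    show "?L (c *\<^sub>R f) = c *\<^sub>R ?L f" if "f \<in> C" for f c
      using that
      by (simp add: lie_bracket_def scaleR_fun_def app[OF X] app[OF Y] tangent_cmult[OF XT] tangent_cmult[OF YT]
          XC YC right_diff_distrib)
    show "?L (f * h) = f x * ?L h + h x * ?L f" if "f \<in> C" "h \<in> C" for f h
      using that
      by (simp add: lie_bracket_def times_fun_def app[OF X] app[OF Y] tangent_mult[OF XT] tangent_mult[OF YT]
          tangent_add[OF XT] tangent_add[OF YT] smooth_functions_mult XC YC)
        (simp add: vf_apply_def algebra_simps)
    show "?L f = 0" if "f \<notin> C" for f
    proof -
      have "vf_apply X f = (\<lambda>y. 0)" "vf_apply Y f = (\<lambda>y. 0)"
        using tangent_nonsmooth[OF XT that] tangent_nonsmooth[OF YT that] by (simp_all add: vf_apply_def)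
      then show ?thesis by (simp add: lie_bracket_def tangent_const[OF XT] tangent_const[OF YT])
    qed
  qed
next
  fix f assume "f \<in> C"
  then have "(\<lambda>x. vf_apply X (vf_apply Y f) x - vf_apply Y (vf_apply X f) x) \<in> C"
    using assms by (intro smooth_functions_diff vf_apply_smooth)
  then show "vf_apply (lie_bracket X Y) f \<in> C"
    by (simp add: vf_apply_def lie_bracket_def)
qed

end


section \<open>The musical isomorphisms\<close>

text \<open>
  The determinant is only available for matrices indexed by finite types; this one makes
  Cramer's rule applicable in the dimension of the model space.
\<close>

typedef (overloaded) 'e basis_index = "Basis :: 'e::euclidean_space set"
  using nonempty_Basis by blast

instance basis_index :: (euclidean_space) finite
proof
  have "inj (Rep_basis_index :: 'a basis_index \<Rightarrow> 'a)"
    by (simp add: inj_def Rep_basis_index_inject)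
  moreover have "range (Rep_basis_index :: 'a basis_index \<Rightarrow> 'a) = Basis"
    using type_definition.Rep_range[OF type_definition_basis_index] .
  ultimately show "finite (UNIV :: 'a basis_index set)"
    using finite_Basis finite_imageD by metis
qed

lemma sum_basis_index:
  "(\<Sum>b\<in>Basis. f b) = (\<Sum>i\<in>UNIV. f (Rep_basis_index (i :: 'e::euclidean_space basis_index)))"
proof -
  have "inj (Rep_basis_index :: 'e basis_index \<Rightarrow> 'e)"
    by (simp add: inj_def Rep_basis_index_inject)
  then show ?thesis
    using sum.reindex[of Rep_basis_index UNIV f]
    by (simp add: type_definition.Rep_range[OF type_definition_basis_index])
qed

context manifold
begin

lemma indexed_frame:
  obtains E :: "'e basis_index \<Rightarrow> 'm vfield" and W where "open W" "x \<in> W" "\<And>i. E i \<in> VF"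
    "\<And>y v. y \<in> W \<Longrightarrow> v \<in> T y \<Longrightarrow> \<exists>c. v = (\<Sum>i\<in>UNIV. c i *\<^sub>R E i y)"
    "\<And>y c i. y \<in> W \<Longrightarrow> (\<Sum>i\<in>UNIV. c i *\<^sub>R E i y) = 0 \<Longrightarrow> c i = 0"
proof -
  obtain E W where W: "open W" "x \<in> W" and E: "\<And>b. E b \<in> VF"
    and span: "\<And>y v. y \<in> W \<Longrightarrow> v \<in> T y \<Longrightarrow> \<exists>c. v = (\<Sum>b\<in>Basis. c b *\<^sub>R E (b::'e) y)"
    and indep: "\<And>y c b. y \<in> W \<Longrightarrow> (\<Sum>b\<in>Basis. c b *\<^sub>R E b y) = 0 \<Longrightarrow> b \<in> Basis \<Longrightarrow> c b = 0"
    by (rule local_frame[of x], rule that)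
  show ?thesis
  proof (rule that[of W "\<lambda>i. E (Rep_basis_index i)"])
    show "\<exists>c. v = (\<Sum>i\<in>UNIV. c i *\<^sub>R E (Rep_basis_index i) y)" if yv: "y \<in> W" "v \<in> T y" for y v
    proof -
      obtain c where "v = (\<Sum>b\<in>Basis. c b *\<^sub>R E b y)" using span[OF yv] by blast
      then show ?thesis
        unfolding sum_basis_index by (intro exI[of _ "\<lambda>i. c (Rep_basis_index i)"])
    qed
    show "c i = 0" if "y \<in> W" "(\<Sum>i\<in>UNIV. c i *\<^sub>R E (Rep_basis_index i) y) = 0" for y c i
    proof -
      have "(\<Sum>b\<in>Basis. c (Abs_basis_index b) *\<^sub>R E b y) = 0"
        using that(2) by (simp add: sum_basis_index Rep_basis_index_inverse)
      then show ?thesis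
        using indep[OF that(1), of "\<lambda>b. c (Abs_basis_index b)" "Rep_basis_index i"]
        by (simp add: Rep_basis_index Rep_basis_index_inverse)
    qed
  qed (use W E in auto)
qed

end

locale metric_manifold = manifold A
  for A :: "('m::{t2_space, second_countable_topology}, 'e::euclidean_space) chart set" +
  fixes g :: "'m \<Rightarrow> 'm tvec \<Rightarrow> 'm tvec \<Rightarrow> real"
  assumes pseudo_riemannian: "pseudo_riemannian_metric A g"
begin

abbreviation "gg \<equiv> metric_apply g"
abbreviation "fl \<equiv> flat A g"

lemma g_lin: "v \<in> T x \<Longrightarrow> lin_on (T x) (g x v)"
  using pseudo_riemannian unfolding pseudo_riemannian_metric_def by blast

lemma g_sym: "v \<in> T x \<Longrightarrow> w \<in> T x \<Longrightarrow> g x v w = g x w v"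
  using pseudo_riemannian unfolding pseudo_riemannian_metric_def by blast

lemma g_nondegenerate: "v \<in> T x \<Longrightarrow> (\<And>w. w \<in> T x \<Longrightarrow> g x v w = 0) \<Longrightarrow> v = 0"
  using pseudo_riemannian unfolding pseudo_riemannian_metric_def by blast

lemma g_smooth: "X \<in> VF \<Longrightarrow> Y \<in> VF \<Longrightarrow> gg X Y \<in> C"
  using pseudo_riemannian by (simp add: pseudo_riemannian_metric_def)

lemma gg_sym: "X \<in> VF \<Longrightarrow> Y \<in> VF \<Longrightarrow> gg X Y = gg Y X"
  by (auto simp: metric_apply_def fun_eq_iff intro!: g_sym vector_fields_tangent)

lemma gg_right:
  assumes "X \<in> VF" "Y \<in> VF"
  shows "Z \<in> VF \<Longrightarrow> gg X (Y + Z) = gg X Y + gg X Z"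
    "Z \<in> VF \<Longrightarrow> gg X (Y - Z) = gg X Y - gg X Z"
    "gg X (c *\<^sub>R Y) = c *\<^sub>R gg X Y"
  using lin_on_add[OF g_lin] lin_on_diff[OF g_lin subspace_tangent_space] lin_on_scaleR[OF g_lin]
    vector_fields_tangent assms
  by (auto simp: metric_apply_def fun_eq_iff scaleR_fun_apply)

lemma gg_left:
  assumes "X \<in> VF" "Y \<in> VF"
  shows "Z \<in> VF \<Longrightarrow> gg (Y + Z) X = gg Y X + gg Z X"
    "Z \<in> VF \<Longrightarrow> gg (Y - Z) X = gg Y X - gg Z X"
    "gg (c *\<^sub>R Y) X = c *\<^sub>R gg Y X"
  using assms subspace_vector_fields
  by (simp_all add: gg_sym[of _ X] gg_right subspace_add subspace_diff subspace_scale)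

lemma flat_at_inj: "inj_on (flat_at A g x) (T x)"
proof (rule inj_onI)
  fix v w assume vw: "v \<in> T x" "w \<in> T x" "flat_at A g x v = flat_at A g x w"
  have "v - w = 0"
  proof (rule g_nondegenerate[of _ x])
    show diff: "v - w \<in> T x" using vw by (simp add: subspace_diff subspace_tangent_space)
    fix u assume u: "u \<in> T x"
    have "g x v u = g x w u"
      using fun_cong[OF vw(3), of u] u by (simp add: flat_at_def extend_zero_def)
    then show "g x (v - w) u = 0"
      using g_sym[OF diff u] lin_on_diff[OF g_lin[OF u] subspace_tangent_space vw(1,2)]
        g_sym[OF vw(1) u] g_sym[OF vw(2) u] by simp
  qed
  then show "v = w" by simp
qed

text \<open>In a local frame, \<open>\<sharp>\<alpha>\<close> solves a linear system with the Gram
  matrix of \<open>g\<close>. Its entries are global smooth functions because the frame fields are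
  global, and hence so are the determinants \<open>N i\<close> and \<open>\<delta>\<close>.\<close>

lemma sharp_local:
  assumes \<alpha>: "\<alpha> \<in> Om"
  obtains E :: "'e basis_index \<Rightarrow> 'm vfield" and W N \<delta> where "open W" "x \<in> W" "\<And>i. E i \<in> VF"
    "\<And>i. N i \<in> C" "\<delta> \<in> C" "\<And>y. y \<in> W \<Longrightarrow> \<delta> y \<noteq> 0"
    "\<And>y. y \<in> W \<Longrightarrow> flat_at A g y (\<Sum>i\<in>UNIV. (N i y / \<delta> y) *\<^sub>R E i y) = \<alpha> y"
proof -
  obtain E :: "'e basis_index \<Rightarrow> 'm vfield" and W where W: "open W" "x \<in> W" and E: "\<And>i. E i \<in> VF"
    and span: "\<And>y v. y \<in> W \<Longrightarrow> v \<in> T y \<Longrightarrow> \<exists>c. v = (\<Sum>i\<in>UNIV. c i *\<^sub>R E i y)"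
    and indep: "\<And>y c i. y \<in> W \<Longrightarrow> (\<Sum>i\<in>UNIV. c i *\<^sub>R E i y) = 0 \<Longrightarrow> c i = 0"
    by (rule indexed_frame[of x], rule that)
  have ET: "E i y \<in> T y" for i y using E vector_fields_tangent by blast
  define G where "G y = (\<chi> i j. gg (E i) (E j) y)" for y
  define a where "a y = (\<chi> i. form_apply \<alpha> (E i) y)" for y
  define \<delta> where "\<delta> y = det (G y)" for y
  \<comment> \<open>The numerator in Cramer's rule: column \<open>k\<close> of the Gram matrix is
    replaced by the values of \<alpha> on the frame.\<close>
  define N where "N k y = det (\<chi> i j. if j = k then a y $ i else G y $ i $ j)" for k y
  have aC: "form_apply \<alpha> (E i) \<in> C" for i
    using \<alpha> E by (simp add: one_forms_def)
  have \<delta>C: "\<delta> \<in> C"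
    unfolding \<delta>_def[abs_def] G_def by (intro smooth_functions_det g_smooth E)
  have NC: "N k \<in> C" for k
  proof -
    have "(\<lambda>y. det (\<chi> i j. (if j = k then form_apply \<alpha> (E i) else gg (E i) (E j)) y)) \<in> C"
      by (rule smooth_functions_det) (simp add: aC g_smooth E)
    moreover have "(\<lambda>y. det (\<chi> i j. (if j = k then form_apply \<alpha> (E i) else gg (E i) (E j)) y)) = N k"
      by (auto simp: N_def a_def G_def fun_eq_iff intro!: arg_cong[where f = det] simp: vec_eq_iff)
    ultimately show ?thesis by simp
  qed
  have Gv: "(G y *v c) $ i = g y (E i y) (\<Sum>j\<in>UNIV. c $ j *\<^sub>R E j y)" for y c i
    by (simp add: lin_on_sum[OF g_lin[OF ET] subspace_tangent_space ET] matrix_vector_mult_def G_def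
        metric_apply_def mult.commute)
  have ST: "(\<Sum>j\<in>UNIV. c j *\<^sub>R E j y) \<in> T y" for y c
    using ET by (intro subspace_sum subspace_scale subspace_tangent_space)
  \<comment> \<open>A kernel vector of the Gram matrix is the coefficient vector of a tangent vector
    orthogonal to the whole frame. Nondegeneracy makes that tangent vector zero, and independence of
    the frame makes its coefficients zero.\<close>
  have nz: "\<delta> y \<noteq> 0" if y: "y \<in> W" for y
  proof -
    have "c = 0" if "G y *v c = 0" for c
    proof -
      let ?w = "\<Sum>j\<in>UNIV. c $ j *\<^sub>R E j y"
      have "?w = 0"
      proof (rule g_nondegenerate[OF ST])
        fix v assume "v \<in> T y"
        then obtain d where d: "v = (\<Sum>i\<in>UNIV. d i *\<^sub>R E i y)" using span[OF y] by blast
        have "g y ?w (E i y) = 0" for i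
          using Gv[of y c i] that g_sym[OF ST ET] by simp
        then show "g y ?w v = 0"
          unfolding d lin_on_sum[OF g_lin[OF ST] subspace_tangent_space ET] by simp
      qed
      then show ?thesis using indep[OF y, of "\<lambda>j. c $ j"] by (simp add: vec_eq_iff)
    qed
    then have "invertible (G y)"
      using matrix_left_invertible_ker[of "G y"] invertible_left_inverse by blast
    then show ?thesis by (simp add: \<delta>_def invertible_det_nz)
  qed
  show ?thesis
  proof (rule that[of W E N \<delta>])
    fix y assume y: "y \<in> W"
    let ?w = "\<Sum>i\<in>UNIV. (N i y / \<delta> y) *\<^sub>R E i y"
    have "G y *v (\<chi> k. N k y / \<delta> y) = a y"
      using cramer[of "G y" "\<chi> k. N k y / \<delta> y" "a y"] nz[OF y] by (simp add: \<delta>_def N_def)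
    then have "g y (E i y) ?w = \<alpha> y (E i y)" for i
      using Gv[of y "\<chi> k. N k y / \<delta> y" i] by (simp add: a_def form_apply_def)
    then have wE: "g y ?w (E i y) = \<alpha> y (E i y)" for i
      using g_sym[OF ST ET] by simp
    have cot: "\<alpha> y \<in> cotangent_space A y" using \<alpha> by (simp add: one_forms_def)
    then have \<alpha>lin: "lin_on (T y) (\<alpha> y)" by (simp add: cotangent_space_def)
    show "flat_at A g y ?w = \<alpha> y"
    proof
      fix v
      show "flat_at A g y ?w v = \<alpha> y v"
      proof (cases "v \<in> T y")
        case True
        then obtain d where d: "v = (\<Sum>i\<in>UNIV. d i *\<^sub>R E i y)" using span[OF y] by blast
        have "g y ?w v = \<alpha> y v"
          unfolding d lin_on_sum[OF g_lin[OF ST] subspace_tangent_space ET]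
            lin_on_sum[OF \<alpha>lin subspace_tangent_space ET] wE ..
        then show ?thesis using True by (simp add: flat_at_def extend_zero_def)
      next
        case False
        then show ?thesis using cot by (simp add: flat_at_def extend_zero_def cotangent_space_def)
      qed
    qed
  qed (use W E NC \<delta>C nz in auto)
qed

text \<open>The local solution shows that each \<open>\<alpha> y\<close> lies in the range of
  \<open>flat_at\<close>; injectivity then identifies the solution with the chosen preimage
  \<open>sharp\<close>. Applied to a smooth function, the field is thus locally a quotient of global
  smooth functions.\<close>

lemma sharp_vector_field:
  assumes \<alpha>: "\<alpha> \<in> Om"
  shows "sharp A g \<alpha> \<in> VF" and "fl (sharp A g \<alpha>) = \<alpha>"
proof -
  have loc: "\<exists>W. open W \<and> x \<in> W \<and> (\<exists>E N \<delta>. (\<forall>i. E i \<in> VF \<and> N i \<in> C) \<and> \<delta> \<in> C \<and> (\<forall>y\<in>W. \<delta> y \<noteq> 0 \<and>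
      flat_at A g y (sharp A g \<alpha> y) = \<alpha> y \<and>
      sharp A g \<alpha> y = (\<Sum>i\<in>UNIV. (N i y / \<delta> y) *\<^sub>R E (i :: 'e basis_index) y)))" for x
  proof -
    obtain E :: "'e basis_index \<Rightarrow> 'm vfield" and W N \<delta> where W: "open W" "x \<in> W" and E: "\<And>i. E i \<in> VF"
      and NC: "\<And>i. N i \<in> C" "\<delta> \<in> C" and nz: "\<And>y. y \<in> W \<Longrightarrow> \<delta> y \<noteq> 0"
      and fl: "\<And>y. y \<in> W \<Longrightarrow> flat_at A g y (\<Sum>i\<in>UNIV. (N i y / \<delta> y) *\<^sub>R E i y) = \<alpha> y"
      by (rule sharp_local[OF \<alpha>, of x], rule that)
    have "sharp A g \<alpha> y = (\<Sum>i\<in>UNIV. (N i y / \<delta> y) *\<^sub>R E i y)" if "y \<in> W" for y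
      unfolding sharp_def
      by (rule inv_into_f_eq[of "flat_at A g y" "T y", OF flat_at_inj _ fl[OF that]])
        (use E vector_fields_tangent in \<open>intro subspace_sum subspace_scale subspace_tangent_space; blast\<close>)
    then show ?thesis
      using W E NC nz fl by (intro exI[of _ W] conjI exI[of _ E] exI[of _ N] exI[of _ \<delta>]) auto
  qed
  show "fl (sharp A g \<alpha>) = \<alpha>"
    unfolding flat_def using loc by blast
  show "sharp A g \<alpha> \<in> VF"
    unfolding vector_fields_def
  proof (intro CollectI conjI allI ballI)
    fix x
    obtain W E N \<delta> where "x \<in> W" and E: "\<And>i. E i \<in> VF"
      and "\<forall>y\<in>W. sharp A g \<alpha> y = (\<Sum>i\<in>UNIV. (N i y / \<delta> y) *\<^sub>R E (i :: 'e basis_index) y)"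
      using loc[of x] by blast
    moreover have "(\<Sum>i\<in>UNIV. (N i x / \<delta> x) *\<^sub>R E i x) \<in> T x"
      by (rule subspace_sum[OF subspace_tangent_space],
          rule subspace_scale[OF subspace_tangent_space], rule vector_fields_tangent[OF E])
    ultimately show "sharp A g \<alpha> x \<in> T x" by simp
  next
    fix f assume f: "f \<in> C"
    show "vf_apply (sharp A g \<alpha>) f \<in> C"
    proof (rule smooth_functions_local_quotient)
      fix x
      obtain W and E :: "'e basis_index \<Rightarrow> 'm vfield" and N \<delta> where W: "open W" "x \<in> W"
        and E: "\<And>i. E i \<in> VF" and N: "\<And>i. N i \<in> C" and \<delta>: "\<delta> \<in> C"
        and eq: "\<forall>y\<in>W. \<delta> y \<noteq> 0 \<and> sharp A g \<alpha> y = (\<Sum>i\<in>UNIV. (N i y / \<delta> y) *\<^sub>R E i y)"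
        using loc[of x] by blast
      have "(\<lambda>y. \<Sum>i\<in>UNIV. N i y * vf_apply (E i) f y) \<in> C"
        by (intro smooth_functions_sum smooth_functions_mult N vf_apply_smooth E f)
      moreover have "\<forall>y\<in>W. \<delta> y \<noteq> 0 \<and>
          vf_apply (sharp A g \<alpha>) f y = (\<Sum>i\<in>UNIV. N i y * vf_apply (E i) f y) / \<delta> y"
        using eq by (simp add: vf_apply_def sum_fun_apply scaleR_fun_apply sum_divide_distrib)
      ultimately show "\<exists>W N \<delta>. open W \<and> x \<in> W \<and> N \<in> C \<and> \<delta> \<in> C \<and>
          (\<forall>y\<in>W. \<delta> y \<noteq> 0 \<and> vf_apply (sharp A g \<alpha>) f y = N y / \<delta> y)"
        using W \<delta> by blast
    qed
  qed
qed

lemma form_apply_flat: "Z \<in> VF \<Longrightarrow> form_apply (fl W) Z = gg W Z"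
  using vector_fields_tangent
  by (auto simp: form_apply_def flat_def flat_at_def extend_zero_def metric_apply_def)

lemma flat_one_form:
  assumes W: "W \<in> VF"
  shows "fl W \<in> Om"
proof -
  have "fl W x \<in> cotangent_space A x" for x
    using g_lin[OF vector_fields_tangent[OF W], of x] subspace_tangent_space[of x]
    by (auto simp: cotangent_space_def flat_def flat_at_def extend_zero_def lin_on_def subspace_add subspace_scale)
  then show ?thesis
    using W by (simp add: one_forms_def form_apply_flat g_smooth)
qed

lemma sharp_flat: "W \<in> VF \<Longrightarrow> sharp A g (fl W) = W"
  by (auto simp: sharp_def flat_def fun_eq_iff vector_fields_tangent inv_into_f_f[OF flat_at_inj])

lemma one_form_cases:
  assumes "\<alpha> \<in> Om"
  obtains W where "W \<in> VF" "\<alpha> = fl W"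
  using sharp_vector_field[OF assms] that by metis

lemma flat_linear:
  assumes "X \<in> VF" "Y \<in> VF"
  shows "fl (X + Y) = fl X + fl Y" "fl (X - Y) = fl X - fl Y" "fl (c *\<^sub>R X) = c *\<^sub>R fl X"
proof -
  have lin: "g x (X x + Y x) v = g x (X x) v + g x (Y x) v" "g x (X x - Y x) v = g x (X x) v - g x (Y x) v"
    "g x (c *\<^sub>R X x) v = c * g x (X x) v" if v: "v \<in> T x" for x v
  proof -
    obtain Z where Z: "Z \<in> VF" "Z x = v" using extend_tangent_vector[OF v] by blast
    show "g x (X x + Y x) v = g x (X x) v + g x (Y x) v" "g x (X x - Y x) v = g x (X x) v - g x (Y x) v"
      "g x (c *\<^sub>R X x) v = c * g x (X x) v"
      using fun_cong[OF gg_left(1)[OF Z(1) assms], of x] fun_cong[OF gg_left(2)[OF Z(1) assms], of x]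
        fun_cong[OF gg_left(3)[OF Z(1) assms(1)], of c x] Z(2)
      by (simp_all add: metric_apply_def scaleR_fun_apply)
  qed
  show "fl (X + Y) = fl X + fl Y" "fl (X - Y) = fl X - fl Y" "fl (c *\<^sub>R X) = c *\<^sub>R fl X"
    by (auto simp: fun_eq_iff flat_def flat_at_def extend_zero_def lin scaleR_fun_apply)
qed

lemma flat_zero: "fl 0 = 0"
  using flat_linear(3)[of 0 0 0] subspace_0[OF subspace_vector_fields] by simp

end


section \<open>The metallic natural connection\<close>

locale metallic_manifold = metric_manifold A g
  for A :: "('m::{t2_space, second_countable_topology}, 'e::euclidean_space) chart set" and g +
  fixes J :: "'m \<Rightarrow> 'm tvec \<Rightarrow> 'm tvec" and p q :: real
    and nab :: "'m vfield \<Rightarrow> 'm vfield \<Rightarrow> 'm vfield"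
  assumes metallic: "metallic_pseudo_riemannian A p q J g"
    and discriminant: "p\<^sup>2 + 4 * q \<noteq> 0"
    and levi_civita: "levi_civita_connection A g nab"
begin

abbreviation "D \<equiv> metallic_natural_connection p q J nab"
abbreviation "JJ \<equiv> endo_apply J"
abbreviation "N \<equiv> cov_deriv_endo nab J"

section \<open>Field-level algebra of \<open>J\<close>\<close>

lemmas VF_closed = subspace_add[OF subspace_vector_fields] subspace_diff[OF subspace_vector_fields]
  subspace_scale[OF subspace_vector_fields]

lemma J_field: "X \<in> VF \<Longrightarrow> JJ X \<in> VF"
  using metallic by (simp add: metallic_pseudo_riemannian_def endomorphism_field_def)

lemma J_lin: "lin_on (T x) (J x)"
  using metallic by (simp add: metallic_pseudo_riemannian_def endomorphism_field_def)

lemma J_linear: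
  assumes "X \<in> VF"
  shows "Y \<in> VF \<Longrightarrow> JJ (X + Y) = JJ X + JJ Y" "Y \<in> VF \<Longrightarrow> JJ (X - Y) = JJ X - JJ Y"
    "JJ (c *\<^sub>R X) = c *\<^sub>R JJ X"
  using assms vector_fields_tangent
    lin_on_add[OF J_lin] lin_on_diff[OF J_lin subspace_tangent_space] lin_on_scaleR[OF J_lin]
  by (auto simp: endo_apply_def fun_eq_iff scaleR_fun_apply)

lemma J_metallic: "X \<in> VF \<Longrightarrow> JJ (JJ X) = p *\<^sub>R JJ X + q *\<^sub>R X"
  using metallic by (simp add: metallic_pseudo_riemannian_def)

lemma J_symmetric: "X \<in> VF \<Longrightarrow> Y \<in> VF \<Longrightarrow> gg (JJ X) Y = gg X (JJ Y)"
  using metallic by (simp add: metallic_pseudo_riemannian_def)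

section \<open>The Levi-Civita connection and the covariant derivative of \<open>J\<close>\<close>

lemma nab_affine: "affine_connection A nab"
  using levi_civita by (simp add: levi_civita_connection_def)

lemma nab_field: "X \<in> VF \<Longrightarrow> Y \<in> VF \<Longrightarrow> nab X Y \<in> VF"
  using nab_affine by (simp add: affine_connection_def)

lemma nab_linear:
  assumes "X \<in> VF" "Y \<in> VF"
  shows "Z \<in> VF \<Longrightarrow> nab X (Y + Z) = nab X Y + nab X Z"
    and "nab X (c *\<^sub>R Y) = c *\<^sub>R nab X Y"
proof -
  show "nab X (Y + Z) = nab X Y + nab X Z" if "Z \<in> VF"
    using nab_affine assms that by (simp add: affine_connection_def)
  \<comment> \<open>Real homogeneity is the Leibniz rule for a constant function, whose derivative
    vanishes.\<close>
  have "nab X (fmult (\<lambda>x. c) Y) = fmult (\<lambda>x. c) (nab X Y) + fmult (vf_apply X (\<lambda>x. c)) Y" for c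
    using nab_affine assms smooth_functions_const by (simp add: affine_connection_def)
  moreover have "vf_apply X (\<lambda>x. c) = (\<lambda>x. 0)" for c
    using tangent_const[OF vector_fields_tangent[OF assms(1)]] by (simp add: vf_apply_def)
  ultimately show "nab X (c *\<^sub>R Y) = c *\<^sub>R nab X Y"
    by (simp add: fmult_def scaleR_fun_def plus_fun_def)
qed

lemma nab_diff:
  assumes "X \<in> VF" "Y \<in> VF" "Z \<in> VF"
  shows "nab X (Y - Z) = nab X Y - nab X Z"
  using nab_linear(1)[of X Y "(-1) *\<^sub>R Z"] nab_linear(2)[of X Z "-1"] VF_closed(3)[of Z "-1"] assms
  by simp

lemma nab_metric:
  "X \<in> VF \<Longrightarrow> Y \<in> VF \<Longrightarrow> Z \<in> VF \<Longrightarrow> vf_apply X (gg Y Z) = gg (nab X Y) Z + gg Y (nab X Z)"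
  using levi_civita by (simp add: levi_civita_connection_def)

lemma N_field: "X \<in> VF \<Longrightarrow> Y \<in> VF \<Longrightarrow> N X Y \<in> VF"
  by (simp add: cov_deriv_endo_def nab_field J_field VF_closed)

lemma D_field: "X \<in> VF \<Longrightarrow> Y \<in> VF \<Longrightarrow> D X Y \<in> VF"
  by (simp add: metallic_natural_connection_def nab_field N_field J_field VF_closed)

text \<open>Equivalently, \<open>2J - p\<close> anticommutes with the covariant derivative of
  \<open>J\<close> in direction \<open>X\<close>. This single relation drives both
  \<open>D_J\<close> and \<open>D_metric\<close>.\<close>

lemma N_J:
  assumes "X \<in> VF" "Y \<in> VF"
  shows "N X (JJ Y) = p *\<^sub>R N X Y - JJ (N X Y)"
  using assms
  by (simp add: cov_deriv_endo_def J_metallic nab_linear nab_field J_field J_linear VF_closed algebra_simps)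

text \<open>Differentiate \<open>g(JY, Z) = g(Y, JZ)\<close> along \<open>X\<close> with the metric
  property of \<open>nab\<close>; symmetry of \<open>J\<close> cancels the terms in which
  \<open>J\<close> is not differentiated.\<close>

lemma N_symmetric:
  assumes "X \<in> VF" "Y \<in> VF" "Z \<in> VF"
  shows "gg (N X Y) Z = gg Y (N X Z)"
proof -
  have "gg (nab X (JJ Y)) Z + gg (JJ Y) (nab X Z) = gg (nab X Y) (JJ Z) + gg Y (nab X (JJ Z))"
    using assms nab_metric[of X "JJ Y" Z] nab_metric[of X Y "JJ Z"] by (simp add: J_symmetric J_field)
  then show ?thesis
    using assms
    by (simp add: cov_deriv_endo_def gg_left gg_right J_symmetric nab_field J_field algebra_simps)
qed

text \<open>Commuting \<open>nab_X\<close> with \<open>J\<close> leaves \<open>N X Y\<close>. With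
  \<open>S = 2J - p\<close>, commuting the correction \<open>k S N\<close> with \<open>J\<close>
  leaves \<open>- k S^2 N\<close>, by \<open>N_J\<close>, and \<open>S^2 = p^2 + 4q\<close> makes
  the two cancel.\<close>

lemma D_J:
  assumes X: "X \<in> VF" and Y: "Y \<in> VF"
  shows "D X (JJ Y) = JJ (D X Y)"
proof -
  define k where "k = 1 / (p\<^sup>2 + 4 * q)"
  have k: "k * (p\<^sup>2 + 4 * q) = 1" using discriminant by (simp add: k_def)
  have k2: "2 / (p\<^sup>2 + 4 * q) = 2 * k" "p / (p\<^sup>2 + 4 * q) = p * k" by (simp_all add: k_def)
  let ?n = "N X Y"
  have n: "?n \<in> VF" using assms N_field by blast
  have "D X (JJ Y) = (JJ (nab X Y) + ?n) + (2 * k) *\<^sub>R JJ (p *\<^sub>R ?n - JJ ?n) - (p * k) *\<^sub>R (p *\<^sub>R ?n - JJ ?n)"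
    by (simp add: metallic_natural_connection_def N_J[OF assms] k2) (simp add: cov_deriv_endo_def)
  also have "\<dots> = JJ (nab X Y) + ?n + (2 * k) *\<^sub>R (p *\<^sub>R JJ ?n - (p *\<^sub>R JJ ?n + q *\<^sub>R ?n))
      - (p * k) *\<^sub>R (p *\<^sub>R ?n - JJ ?n)"
    using n by (simp add: J_linear J_field VF_closed J_metallic)
  also have "\<dots> = JJ (nab X Y) + (1 - 2 * k * q - p * k * p) *\<^sub>R ?n + (p * k) *\<^sub>R JJ ?n"
    by (simp add: algebra_simps)
  \<comment> \<open>Replace 1 by \<open>k * (p^2 + 4 * q)\<close>; this is where the normalisation
    by the discriminant enters.\<close>
  also have "1 - 2 * k * q - p * k * p = 2 * k * q"
    using k by (simp add: algebra_simps power2_eq_square)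
  \<comment> \<open>The coefficient is split so that the terms regroup into a multiple of
    \<open>J^2 = pJ + q\<close> applied to \<open>?n\<close> and the term \<open>- (p * k)\<close>
    of the correction.\<close>
  also have "p * k = 2 * k * p - p * k" by simp
  also have "JJ (nab X Y) + (2 * k * q) *\<^sub>R ?n + (2 * k * p - p * k) *\<^sub>R JJ ?n
      = JJ (nab X Y) + (2 * k) *\<^sub>R (p *\<^sub>R JJ ?n + q *\<^sub>R ?n) - (p * k) *\<^sub>R JJ ?n"
    by (simp only: scaleR_add_right scaleR_add_left scaleR_minus_left scaleR_scaleR diff_conv_add_uminus add_ac)
  also have "\<dots> = JJ (nab X Y + (2 * k) *\<^sub>R JJ ?n - (p * k) *\<^sub>R ?n)"
    using n assms by (simp add: J_linear J_field VF_closed J_metallic nab_field)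
  also have "\<dots> = JJ (D X Y)"
    by (simp add: metallic_natural_connection_def k2)
  finally show ?thesis .
qed

text \<open>Adding an endomorphism to a metric connection keeps it metric if the endomorphism is
  \<open>g\<close>-skew. Moving \<open>J\<close> and \<open>N\<close> across \<open>g\<close> and
  applying \<open>N_J\<close> shows that the correction \<open>a J N - b N\<close> is skew because
  \<open>a * p = 2 * b\<close>.\<close>

lemma D_metric:
  assumes "X \<in> VF" "Y \<in> VF" "Z \<in> VF"
  shows "vf_apply X (gg Y Z) = gg (D X Y) Z + gg Y (D X Z)"
proof -
  define a b where "a = 2 / (p\<^sup>2 + 4 * q)" and "b = p / (p\<^sup>2 + 4 * q)"
  have ab: "a * p = 2 * b" by (simp add: a_def b_def)
  have n: "N X Y \<in> VF" "N X Z \<in> VF" using assms N_field by auto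
  have "gg (JJ (N X Y)) Z = gg Y (N X (JJ Z))"
    using assms n by (simp add: J_symmetric N_symmetric J_field)
  also have "\<dots> = p *\<^sub>R gg Y (N X Z) - gg Y (JJ (N X Z))"
    using assms n by (simp add: N_J gg_right J_field VF_closed)
  finally have skew: "gg (JJ (N X Y)) Z = p *\<^sub>R gg Y (N X Z) - gg Y (JJ (N X Z))" .
  have "gg (D X Y) Z + gg Y (D X Z) = gg (nab X Y) Z + gg Y (nab X Z)
      + (a *\<^sub>R gg (JJ (N X Y)) Z - b *\<^sub>R gg (N X Y) Z + a *\<^sub>R gg Y (JJ (N X Z)) - b *\<^sub>R gg Y (N X Z))"
    unfolding metallic_natural_connection_def a_def[symmetric] b_def[symmetric]
    using assms n by (simp add: gg_left gg_right nab_field J_field VF_closed)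
  also have "a *\<^sub>R gg (JJ (N X Y)) Z - b *\<^sub>R gg (N X Y) Z + a *\<^sub>R gg Y (JJ (N X Z)) - b *\<^sub>R gg Y (N X Z)
      = (a * p - 2 * b) *\<^sub>R gg Y (N X Z)"
    by (simp add: skew N_symmetric[OF assms] algebra_simps flip: scaleR_add_left)
  finally have "gg (D X Y) Z + gg Y (D X Z) = gg (nab X Y) Z + gg Y (nab X Z)"
    by (simp only: ab diff_self scaleR_zero_left add_0_right)
  then show ?thesis by (simp only: nab_metric[OF assms])
qed

lemma D_linear:
  assumes "X \<in> VF" "Y \<in> VF"
  shows "Z \<in> VF \<Longrightarrow> D X (Y + Z) = D X Y + D X Z"
    and "Z \<in> VF \<Longrightarrow> D X (Y - Z) = D X Y - D X Z"
    and "D X (c *\<^sub>R Y) = c *\<^sub>R D X Y"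
  using assms
  by (simp_all add: metallic_natural_connection_def cov_deriv_endo_def nab_linear nab_diff nab_field J_field
      J_linear VF_closed algebra_simps)

text \<open>The definite description is resolved here: metric compatibility of \<open>D\<close>
  makes \<open>fl (D X W)\<close> a solution, and \<open>one_form_eqI\<close> makes it the only
  one.\<close>

lemma form_connection_flat:
  assumes "X \<in> VF" "W \<in> VF"
  shows "form_connection A D X (fl W) = fl (D X W)"
  unfolding form_connection_def
proof (rule the_equality)
  have *: "form_apply (fl (D X W)) Z = vf_apply X (form_apply (fl W) Z) - form_apply (fl W) (D X Z)"
    if "Z \<in> VF" for Z
    using that assms by (simp add: form_apply_flat D_field D_metric)
  then show "fl (D X W) \<in> Om \<and> (\<forall>Z\<in>VF. form_apply (fl (D X W)) Z
      = vf_apply X (form_apply (fl W) Z) - form_apply (fl W) (D X Z))"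
    using assms by (simp add: flat_one_form D_field)
  fix \<gamma> assume "\<gamma> \<in> Om \<and> (\<forall>Z\<in>VF. form_apply \<gamma> Z
      = vf_apply X (form_apply (fl W) Z) - form_apply (fl W) (D X Z))"
  then show "\<gamma> = fl (D X W)"
    using * assms by (intro one_form_eqI) (auto simp: flat_one_form D_field)
qed

lemma dual_endo_flat:
  assumes W: "W \<in> VF"
  shows "dual_endo A J (fl W) = fl (JJ W)"
proof -
  have "g x (W x) (J x v) = g x (J x (W x)) v" "J x v \<in> T x" if v: "v \<in> T x" for x v
  proof -
    obtain Z where Z: "Z \<in> VF" "Z x = v" using extend_tangent_vector[OF v] by blast
    show "g x (W x) (J x v) = g x (J x (W x)) v"
      using fun_cong[OF J_symmetric[OF W Z(1)], of x] Z(2) by (simp add: metric_apply_def endo_apply_def)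
    show "J x v \<in> T x"
      using vector_fields_tangent[OF J_field[OF Z(1)], of x] Z(2) by (simp add: endo_apply_def)
  qed
  then show ?thesis
    by (auto simp: fun_eq_iff dual_endo_def flat_def flat_at_def extend_zero_def endo_apply_def)
qed

text \<open>After identifying 1-forms with fields, the generalized structure is a block matrix whose
  entries are polynomials in \<open>J\<close> with constant coefficients, so it commutes with
  \<open>D\<close> acting on both components as soon as \<open>J\<close> does. Likewise
  \<open>gen_g_flat\<close> expresses the generalized metric by \<open>g\<close> and
  \<open>J\<close> alone.\<close>

lemma gen_J_flat:
  "Y \<in> VF \<Longrightarrow> W \<in> VF \<Longrightarrow> gen_J A p J g (Y, fl W) = (JJ Y, fl (Y - JJ W + p *\<^sub>R W))"
  by (simp add: dual_endo_flat flat_linear J_field VF_closed)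

lemma gen_g_flat:
  assumes "Y \<in> VF" "W \<in> VF" "Z \<in> VF" "V \<in> VF"
  shows "gen_g A p q J g (Y, fl W) (Z, fl V) = gg Y Z + gg W V
     + (p / (p\<^sup>2 + 4 * q)) *\<^sub>R (gg W Z + gg V Y) - (2 / (p\<^sup>2 + 4 * q)) *\<^sub>R (gg W (JJ Z) + gg V (JJ Y))"
  using assms by (simp add: sharp_flat form_apply_flat J_field)

lemma vf_apply_linear:
  assumes "X \<in> VF" "f \<in> C"
  shows "h \<in> C \<Longrightarrow> vf_apply X (f + h) = vf_apply X f + vf_apply X h"
    "h \<in> C \<Longrightarrow> vf_apply X (f - h) = vf_apply X f - vf_apply X h"
    "vf_apply X (c *\<^sub>R f) = c *\<^sub>R vf_apply X f"
proof -
  have lin: "lin_on C (X x)" for x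
    using tangent_lin_on vector_fields_tangent assms(1) by blast
  show "h \<in> C \<Longrightarrow> vf_apply X (f + h) = vf_apply X f + vf_apply X h"
    "h \<in> C \<Longrightarrow> vf_apply X (f - h) = vf_apply X f - vf_apply X h"
    "vf_apply X (c *\<^sub>R f) = c *\<^sub>R vf_apply X f"
    using assms(2)
    by (auto simp: vf_apply_def fun_eq_iff scaleR_fun_apply lin_on_add[OF lin] lin_on_scaleR[OF lin]
        lin_on_diff[OF lin subspace_smooth_functions])
qed

section \<open>Parallelism and curvature on the generalized tangent bundle\<close>

lemma gen_section_cases:
  assumes "\<sigma> \<in> gen_sections A"
  obtains X W where "\<sigma> = (X, fl W)" "X \<in> VF" "W \<in> VF"
  using assms unfolding gen_sections_def by (metis SigmaE one_form_cases)

lemma parallel_gen_J: "parallel_gen_endo A (gen_connection A D) (gen_J A p J g)"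
  unfolding parallel_gen_endo_def
proof (intro ballI)
  fix \<sigma> \<tau> assume "\<sigma> \<in> gen_sections A" "\<tau> \<in> gen_sections A"
  then obtain X V Y W where st: "\<sigma> = (X, fl V)" "\<tau> = (Y, fl W)" and VF: "X \<in> VF" "Y \<in> VF" "W \<in> VF"
    by (metis gen_section_cases)
  show "gen_connection A D \<sigma> (gen_J A p J g \<tau>) = gen_J A p J g (gen_connection A D \<sigma> \<tau>)"
    unfolding st using VF
    by (simp add: gen_J_flat form_connection_flat D_linear D_field D_J J_field VF_closed del: gen_J.simps)
qed

lemma parallel_gen_g: "parallel_gen_metric A (gen_connection A D) (gen_g A p q J g)"
  unfolding parallel_gen_metric_def
proof (intro ballI)
  fix \<sigma> \<tau> \<rho> assume "\<sigma> \<in> gen_sections A" "\<tau> \<in> gen_sections A" "\<rho> \<in> gen_sections A"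
  then obtain X U Y W Z V where st: "\<sigma> = (X, fl U)" "\<tau> = (Y, fl W)" "\<rho> = (Z, fl V)"
    and VF: "X \<in> VF" "Y \<in> VF" "W \<in> VF" "Z \<in> VF" "V \<in> VF"
    by (metis gen_section_cases)
  note cl = g_smooth J_field subspace_add[OF subspace_smooth_functions]
    subspace_scale[OF subspace_smooth_functions]
  show "vf_apply (fst \<sigma>) (gen_g A p q J g \<tau> \<rho>) =
      gen_g A p q J g (gen_connection A D \<sigma> \<tau>) \<rho> + gen_g A p q J g \<tau> (gen_connection A D \<sigma> \<rho>)"
    unfolding st using VF
    by (simp add: gen_g_flat form_connection_flat D_field vf_apply_linear cl D_metric D_J
        algebra_simps del: gen_g.simps)
qed

text \<open>A direction enters the generalized connection only through its vector part, so
  \<open>\<alpha>\<close>, \<open>\<beta>\<close> and the form part of the bracket disappear. On the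
  1-form component the curvature is that of \<open>D\<close> transported by
  \<open>\<flat>\<close>.\<close>

lemma curvature_gen_connection:
  assumes "X \<in> VF" "Y \<in> VF" "Z \<in> VF" "\<alpha> \<in> Om" "\<beta> \<in> Om" "W \<in> VF"
  shows "curvature (bracket_D A D) (gen_connection A D) (X, \<alpha>) (Y, \<beta>) (Z, fl W) =
    (curvature lie_bracket D X Y Z, fl (curvature lie_bracket D X Y W))"
  using assms
  by (simp add: curvature_def form_connection_flat D_field lie_bracket_vector_field flat_linear VF_closed)

lemma flat_gen_connection_iff:
  "flat_connection (gen_sections A) (bracket_D A D) (gen_connection A D) \<longleftrightarrow>
   flat_connection VF lie_bracket D"
proof
  assume flat: "flat_connection (gen_sections A) (bracket_D A D) (gen_connection A D)"
  \<comment> \<open>The zero form is written \<open>fl 0\<close> to match the shape required by the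
    curvature formula; sections without form part suffice to recover the curvature of
    \<open>D\<close>.\<close>
  have zero: "fl 0 \<in> Om" "0 \<in> VF"
    using flat_one_form subspace_0[OF subspace_vector_fields] by auto
  show "flat_connection VF lie_bracket D"
    unfolding flat_connection_def
  proof (intro ballI)
    fix X Y Z assume VF: "X \<in> VF" "Y \<in> VF" "Z \<in> VF"
    have "curvature (bracket_D A D) (gen_connection A D) (X, fl 0) (Y, fl 0) (Z, fl 0) = 0"
      using flat VF zero by (simp add: flat_connection_def gen_sections_def)
    then show "curvature lie_bracket D X Y Z = 0"
      using curvature_gen_connection[OF VF zero(1,1,2)] by (simp add: zero_prod_def)
  qed
next
  assume flat: "flat_connection VF lie_bracket D"
  show "flat_connection (gen_sections A) (bracket_D A D) (gen_connection A D)"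
    unfolding flat_connection_def
  proof (intro ballI)
    fix \<sigma> \<tau> \<rho> assume "\<sigma> \<in> gen_sections A" "\<tau> \<in> gen_sections A" "\<rho> \<in> gen_sections A"
    then obtain X U Y W Z V where st: "\<sigma> = (X, fl U)" "\<tau> = (Y, fl W)" "\<rho> = (Z, fl V)"
      and VF: "X \<in> VF" "Y \<in> VF" "Z \<in> VF" "U \<in> VF" "W \<in> VF" "V \<in> VF"
      by (metis gen_section_cases)
    show "curvature (bracket_D A D) (gen_connection A D) \<sigma> \<tau> \<rho> = 0"
      unfolding st using VF flat
      by (simp add: curvature_gen_connection flat_one_form flat_connection_def flat_zero zero_prod_def)
  qed
qed

end

theorem theorem6p2:
  fixes A :: "('m::{t2_space, second_countable_topology}, 'e::euclidean_space) chart set"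
    and J :: "'m \<Rightarrow> 'm tvec \<Rightarrow> 'm tvec"
    and g :: "'m \<Rightarrow> 'm tvec \<Rightarrow> 'm tvec \<Rightarrow> real"
    and p q :: real
    and nab D :: "'m vfield \<Rightarrow> 'm vfield \<Rightarrow> 'm vfield"
    and Dh :: "'m gsec \<Rightarrow> 'm gsec \<Rightarrow> 'm gsec"
  assumes "metallic_pseudo_riemannian A p q J g"
    and "p\<^sup>2 + 4 * q \<noteq> 0"
    and "levi_civita_connection A g nab"
    and "D = metallic_natural_connection p q J nab"
    and "Dh = gen_connection A D"
  shows "parallel_gen_endo A Dh (gen_J A p J g) \<and>
    parallel_gen_metric A Dh (gen_g A p q J g) \<and>
    (\<forall>X\<in>vector_fields A. \<forall>Y\<in>vector_fields A. \<forall>\<alpha>\<in>one_forms A. \<forall>\<beta>\<in>one_forms A.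
       torsion (bracket_D A D) Dh (X, \<alpha>) (Y, \<beta>) = (torsion lie_bracket D X Y, 0)) \<and>
    (flat_connection (gen_sections A) (bracket_D A D) Dh \<longleftrightarrow>
     flat_connection (vector_fields A) lie_bracket D)"
proof -
  interpret metallic_manifold A g J p q nab
    using assms(1-3) by unfold_locales (auto simp: metallic_pseudo_riemannian_def)
  \<comment> \<open>The torsion claim is immediate on unfolding: the form part of
    \<open>bracket_D\<close> is exactly the antisymmetrised derivative of the form parts, so it
    cancels.\<close>
  show ?thesis
    using parallel_gen_J parallel_gen_g flat_gen_connection_iff
    by (simp add: assms(4,5) torsion_def)
qed

end
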